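(* Determining whether an asynchronous program with cancel has an infinite run is undecidable.
   Context: Multisets over a finite set $\Sigma$ are maps $\Sigma\to\mathbb{N}$; $\oplus$ is pointwise sum and $[\sigma]$ the multiset with one copy of $\sigma$. For a word $w$ and letter $b$, $\mathsf{Parikh}(w)(b)$ is the number of occurrences of $b$ in $w$. Let $\Sigma$ be a finite alphabet of handler names and $\overline\Sigma=\{\bar\sigma\mid\sigma\in\Sigma\}$ a disjoint copy; let $\Sigma_i$ be an alphabet of internal actions disjoint from both, and $\Gamma=\Sigma_i\cup\Sigma\cup\overline\Sigma$. An asynchronous program with cancel is $\mathfrak P=(D,\Sigma\cup\overline\Sigma,\Sigma_i,G,R,d_0,\mathbf m_0)$ with $D$ a finite set of global states, $G=(\mathcal X,\Gamma,\mathcal P)$ a context-free grammar (productions in $\mathcal X\times(\mathcal X^2\cup\Gamma\cup\{\varepsilon\})$) with a nonterminal $X_\sigma$ for each $\sigma\in\Sigma$, $R=(D,\Gamma,\delta)$ a regular grammar with nonterminal set $D$ (productions $d\to a\,d'$, $a\in\Gamma$, or $d\to\varepsilon$), $\mathbf m_0$ a multiset over $\Sigma$, $d_0\in D$. Configurations are pairs $(d,\mathbf m)$. There is a transition $(d,\mathbf m\oplus[\sigma])\xrightarrow{\sigma}(d',\mathbf m')$ iff there is $w\in\Gamma^*$ with $d\Rightarrow_R^* w\,d'$, $X_\sigma\Rightarrow_G^* w$, and for every $b\in\Sigma$ either (i) $w=w_1\bar b w_2$ with $w_2\in(\Gamma\setminus\{\bar b\})^*$ and $\mathbf m'(b)=\mathsf{Parikh}(w_2)(b)$,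 or (ii) $w\in(\Gamma\setminus\{\bar b\})^*$ and $\mathbf m'(b)=\mathbf m(b)+\mathsf{Parikh}(w)(b)$. An infinite run is an infinite sequence of configurations starting at $(d_0,\mathbf m_0)$ with consecutive configurations related by transitions. *)

theory Defs
  imports "HOL-Library.Multiset" "HOL-Library.FuncSet" "HOL-Library.Nat_Bijection"
begin

section \<open>Grammars\<close>

text \<open>Sentential forms are words over nonterminals (\<open>Inl\<close>) and terminals (\<open>Inr\<close>).\<close>

type_synonym ('n, 't) production = "'n \<times> ('n + 't) list"

inductive derive1 :: "('n, 't) production set \<Rightarrow> ('n + 't) list \<Rightarrow> ('n + 't) list \<Rightarrow> bool"
  for \<P> where
  "(A, \<alpha>) \<in> \<P> \<Longrightarrow> derive1 \<P> (u @ [Inl A] @ v) (u @ \<alpha> @ v)"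

definition derives :: "('n, 't) production set \<Rightarrow> ('n + 't) list \<Rightarrow> ('n + 't) list \<Rightarrow> bool" where
  "derives \<P> = (derive1 \<P>)\<^sup>*\<^sup>*"

section \<open>Asynchronous programs with cancel\<close>

text \<open>The three constructors make the internal actions, the handler names and the barred
  handler names pairwise disjoint: \<open>Cancel \<sigma>\<close> is the barred copy of \<open>\<sigma>\<close>.\<close>

datatype ('s, 'i) letter = Internal 'i | Post 's | Cancel 's

record ('d, 's, 'i, 'x) acp =
  states :: "'d set"
  handlers :: "'s set"
  internals :: "'i set"
  nonterminals :: "'x set"
  cfg_prods :: "('x, ('s, 'i) letter) production set"
  handler_nt :: "'s \<Rightarrow> 'x"
  reg_prods :: "('d, ('s, 'i) letter) production set"
  init_state :: "'d"
  init_pending :: "'s multiset"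

definition alphabet :: "('d, 's, 'i, 'x) acp \<Rightarrow> ('s, 'i) letter set" where
  "alphabet P = Internal ` internals P \<union> Post ` handlers P \<union> Cancel ` handlers P"

text \<open>The family of nonterminals \<open>handler_nt P\<close> is indexed by \<open>handlers P\<close> only; the extensional
  function space fixes its irrelevant values elsewhere, so that a program is determined by its
  finite description.\<close>

definition async_program :: "('d, 's, 'i, 'x) acp \<Rightarrow> bool" where
  "async_program P \<longleftrightarrow>
     finite (states P) \<and> finite (handlers P) \<and> finite (internals P) \<and> finite (nonterminals P) \<and>
     cfg_prods P \<subseteq> nonterminals P \<times>
       ({[Inl Y, Inl Z] | Y Z. Y \<in> nonterminals P \<and> Z \<in> nonterminals P} \<union>
        {[Inr a] | a. a \<in> alphabet P} \<union> {[]}) \<and>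
     handler_nt P \<in> handlers P \<rightarrow>\<^sub>E nonterminals P \<and>
     reg_prods P \<subseteq> states P \<times>
       ({[Inr a, Inl d] | a d. a \<in> alphabet P \<and> d \<in> states P} \<union> {[]}) \<and>
     init_state P \<in> states P \<and>
     set_mset (init_pending P) \<subseteq> handlers P"

type_synonym ('d, 's) config = "'d \<times> 's multiset"

definition configs :: "('d, 's, 'i, 'x) acp \<Rightarrow> ('d, 's) config set" where
  "configs P = states P \<times> {m. set_mset m \<subseteq> handlers P}"

definition parikh :: "'a list \<Rightarrow> 'a \<Rightarrow> nat" where
  "parikh w b = count_list w b"

definition transition ::
  "('d, 's, 'i, 'x) acp \<Rightarrow> ('d, 's) config \<Rightarrow> 's \<Rightarrow> ('d, 's) config \<Rightarrow> bool" where
  "transition P c \<sigma> c' \<longleftrightarrow> c \<in> configs P \<and> c' \<in> configs P \<and> \<sigma> \<in> handlers P \<and>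
     (\<exists>d m d' m' w. c = (d, m + {#\<sigma>#}) \<and> c' = (d', m') \<and>
        w \<in> lists (alphabet P) \<and>
        derives (reg_prods P) [Inl d] (map Inr w @ [Inl d']) \<and>
        derives (cfg_prods P) [Inl (handler_nt P \<sigma>)] (map Inr w) \<and>
        (\<forall>b \<in> handlers P.
          (\<exists>w1 w2. w = w1 @ [Cancel b] @ w2 \<and> w2 \<in> lists (alphabet P - {Cancel b}) \<and>
             count m' b = parikh w2 (Post b)) \<or>
          (w \<in> lists (alphabet P - {Cancel b}) \<and>
             count m' b = count m b + parikh w (Post b))))"

definition has_infinite_run :: "('d, 's, 'i, 'x) acp \<Rightarrow> bool" where
  "has_infinite_run P \<longleftrightarrow>
     (\<exists>\<rho>. \<rho> 0 = (init_state P, init_pending P) \<and>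
          (\<forall>i::nat. \<exists>\<sigma>. transition P (\<rho> i) \<sigma> (\<rho> (Suc i))))"

section \<open>Partial recursive functions and decidability\<close>

text \<open>Kleene's partial recursive functions. Terms carry no arity annotation:
  \<open>rec_eval f xs y\<close> says that \<open>f\<close>, applied to the argument tuple \<open>xs\<close>, is defined with
  value \<open>y\<close>; a term applied to too few arguments is undefined.\<close>

datatype recf = Zero | Succ | Proj nat | Comp recf "recf list" | PrimRec recf recf | Mu recf

inductive rec_eval :: "recf \<Rightarrow> nat list \<Rightarrow> nat \<Rightarrow> bool" where
  "rec_eval Zero xs 0"
| "rec_eval Succ [x] (Suc x)"
| "i < length xs \<Longrightarrow> rec_eval (Proj i) xs (xs ! i)"
| "list_all2 (\<lambda>g y. rec_eval g xs y) gs ys \<Longrightarrow> rec_eval f ys z \<Longrightarrow> rec_eval (Comp f gs) xs z"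
| "rec_eval f xs y \<Longrightarrow> rec_eval (PrimRec f g) (0 # xs) y"
| "rec_eval (PrimRec f g) (n # xs) r \<Longrightarrow> rec_eval g (n # r # xs) y \<Longrightarrow>
     rec_eval (PrimRec f g) (Suc n # xs) y"
| "rec_eval f (n # xs) 0 \<Longrightarrow> (\<And>i. i < n \<Longrightarrow> \<exists>y. rec_eval f (i # xs) (Suc y)) \<Longrightarrow>
     rec_eval (Mu f) xs n"

inductive_cases rec_eval_elims:
  "rec_eval Zero xs y" "rec_eval Succ xs y" "rec_eval (Proj i) xs y"
  "rec_eval (Comp f gs) xs y" "rec_eval (PrimRec f g) (0 # xs) y"
  "rec_eval (PrimRec f g) (Suc n # xs) y" "rec_eval (Mu f) xs y"

lemma rec_eval_deterministic: "rec_eval f xs y \<Longrightarrow> rec_eval f xs z \<Longrightarrow> y = z"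
proof (induction arbitrary: z rule: rec_eval.induct)
  case (1 xs)
  then show ?case by (rule rec_eval_elims(1)) simp
next
  case (2 x)
  then show ?case by (rule rec_eval_elims(2)) simp
next
  case (3 i xs)
  from 3(2) show ?case by (rule rec_eval_elims(3)) simp
next
  case (4 xs gs ys f u)
  from 4(4) obtain ys' where ys': "list_all2 (\<lambda>g y. rec_eval g xs y) gs ys'" "rec_eval f ys' z"
    by (rule rec_eval_elims(4))
  have "ys = ys'"
  proof (rule nth_equalityI)
    show "length ys = length ys'"
      using 4(1) ys'(1) by (simp add: list_all2_conv_all_nth)
    show "ys ! i = ys' ! i" if "i < length ys" for i
      using 4(1) ys'(1) that unfolding list_all2_conv_all_nth by metis
  qed
  with 4 ys'(2) show ?case by blast
next
  case (5 f xs y g)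
  from 5(3) have "rec_eval f xs z" by (rule rec_eval_elims(5))
  then show ?case by (rule 5(2))
next
  case (6 f g n xs r y)
  from 6(5) obtain r' where "rec_eval (PrimRec f g) (n # xs) r'" "rec_eval g (n # r' # xs) z"
    by (rule rec_eval_elims(6))
  with 6(3,4) show ?case by blast
next
  case (7 f n xs)
  from 7(4) have z: "rec_eval f (z # xs) 0" "\<forall>i<z. \<exists>y. rec_eval f (i # xs) (Suc y)"
    by (rule rec_eval_elims(7), blast)+
  have "\<not> n < z" using 7(2) z(2) by blast
  moreover have "\<not> z < n" using 7(3) z(1) by blast
  ultimately show ?case by simp
qed

text \<open>A decision problem is given by a set of instances \<open>I\<close>, their codes (\<open>code p n\<close>: the number
  \<open>n\<close> is a code of \<open>p\<close>) and the property \<open>Q\<close> to be decided. A decision procedure has to answer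
  correctly on every code of an instance; it need not terminate on numbers that are not codes.\<close>

definition decidable :: "('a \<Rightarrow> nat \<Rightarrow> bool) \<Rightarrow> 'a set \<Rightarrow> ('a \<Rightarrow> bool) \<Rightarrow> bool" where
  "decidable code I Q \<longleftrightarrow>
     (\<exists>f. \<forall>p \<in> I. \<forall>n. code p n \<longrightarrow> rec_eval f [n] (if Q p then 1 else 0))"

section \<open>Codes of programs\<close>

fun letter_encode :: "(nat, nat) letter \<Rightarrow> nat" where
  "letter_encode (Internal i) = prod_encode (0, i)"
| "letter_encode (Post \<sigma>) = prod_encode (1, \<sigma>)"
| "letter_encode (Cancel \<sigma>) = prod_encode (2, \<sigma>)"

definition symbol_encode :: "nat + (nat, nat) letter \<Rightarrow> nat" where
  "symbol_encode s = sum_encode (map_sum id letter_encode s)"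

definition production_encode :: "(nat, (nat, nat) letter) production \<Rightarrow> nat" where
  "production_encode = (\<lambda>(A, \<alpha>). prod_encode (A, list_encode (map symbol_encode \<alpha>)))"

text \<open>The finite sets and the multiset of a program are presented by lists of their elements, in
  any order and, for the sets, possibly with repetitions; hence a program has several codes.\<close>

definition program_code :: "(nat, nat, nat, nat) acp \<Rightarrow> nat \<Rightarrow> bool" where
  "program_code P n \<longleftrightarrow> (\<exists>ds hs is xs ps rs ms.
     set ds = states P \<and> set hs = handlers P \<and> set is = internals P \<and> set xs = nonterminals P \<and>
     set ps = cfg_prods P \<and> set rs = reg_prods P \<and> mset ms = init_pending P \<and>
     n = list_encode
       [list_encode ds,
        list_encode (map (\<lambda>\<sigma>. prod_encode (\<sigma>, handler_nt P \<sigma>)) hs),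
        list_encode is,
        list_encode xs,
        list_encode (map production_encode ps),
        list_encode (map production_encode rs),
        init_state P,
        list_encode ms])"

lemma letter_encode_inj: "letter_encode a = letter_encode b \<Longrightarrow> a = b"
  by (cases a; cases b) auto

lemma symbol_encode_inj: "inj symbol_encode"
proof (rule injI)
  fix s t assume "symbol_encode s = symbol_encode t"
  then have "map_sum id letter_encode s = map_sum id letter_encode t"
    by (simp add: symbol_encode_def sum_encode_eq)
  then show "s = t" by (cases s; cases t) (auto dest: letter_encode_inj)
qed

lemma production_encode_inj: "inj production_encode"
  by (rule injI) (auto simp: production_encode_def list_encode_eq inj_map_eq_map[OF symbol_encode_inj])

lemma program_code_exists:
  assumes "async_program P"
  shows "\<exists>n. program_code P n"
proof -
  have "finite (alphabet P)" using assms by (simp add: async_program_def alphabet_def)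
  moreover have "finite (states P)" "finite (nonterminals P)"
    using assms by (auto simp: async_program_def)
  ultimately have fin:
    "finite (nonterminals P \<times> ((\<lambda>(Y, Z). [Inl Y, Inl Z]) ` (nonterminals P \<times> nonterminals P) \<union>
       (\<lambda>a. [Inr a]) ` alphabet P \<union> {[]}))" (is "finite ?A")
    "finite (states P \<times> ((\<lambda>(a, d). [Inr a, Inl d]) ` (alphabet P \<times> states P) \<union> {[]}))"
    (is "finite ?B")
    by simp_all
  have eqs:
    "{[Inl Y, Inl Z] | Y Z. Y \<in> nonterminals P \<and> Z \<in> nonterminals P} =
       (\<lambda>(Y, Z). [Inl Y, Inl Z]) ` (nonterminals P \<times> nonterminals P)"
    "{[Inr a] | a. a \<in> alphabet P} = (\<lambda>a. [Inr a]) ` alphabet P"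
    "{[Inr a, Inl d] | a d. a \<in> alphabet P \<and> d \<in> states P} =
       (\<lambda>(a, d). [Inr a, Inl d]) ` (alphabet P \<times> states P)"
    by auto
  have "cfg_prods P \<subseteq> ?A" "reg_prods P \<subseteq> ?B"
    using assms unfolding async_program_def eqs by simp_all
  with fin have "finite (cfg_prods P)" "finite (reg_prods P)"
    by (simp_all only: finite_subset[of "cfg_prods P" ?A] finite_subset[of "reg_prods P" ?B])
  then obtain ps rs where "set ps = cfg_prods P" "set rs = reg_prods P"
    using finite_list by meson
  moreover have "finite (states P)" "finite (handlers P)" "finite (internals P)"
    "finite (nonterminals P)"
    using assms by (simp_all add: async_program_def)
  then obtain ds hs "is" xs where
    "set ds = states P" "set hs = handlers P" "set is = internals P" "set xs = nonterminals P"
    using finite_list by meson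
  moreover obtain ms where "mset ms = init_pending P"
    using ex_mset by blast
  ultimately show ?thesis
    unfolding program_code_def by blast
qed

lemma program_code_unambiguous:
  assumes "async_program P" "async_program Q" "program_code P n" "program_code Q n"
  shows "P = Q"
proof -
  note inj = inj_map_eq_map[OF production_encode_inj]
  from assms(3) obtain ds hs "is" xs ps rs ms where p:
    "set ds = states P" "set hs = handlers P" "set is = internals P" "set xs = nonterminals P"
    "set ps = cfg_prods P" "set rs = reg_prods P" "mset ms = init_pending P"
    "n = list_encode
       [list_encode ds, list_encode (map (\<lambda>\<sigma>. prod_encode (\<sigma>, handler_nt P \<sigma>)) hs),
        list_encode is, list_encode xs, list_encode (map production_encode ps),
        list_encode (map production_encode rs), init_state P, list_encode ms]"
    unfolding program_code_def by blast
  from assms(4) obtain ds' hs' is' xs' ps' rs' ms' where q: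
    "set ds' = states Q" "set hs' = handlers Q" "set is' = internals Q" "set xs' = nonterminals Q"
    "set ps' = cfg_prods Q" "set rs' = reg_prods Q" "mset ms' = init_pending Q"
    "n = list_encode
       [list_encode ds', list_encode (map (\<lambda>\<sigma>. prod_encode (\<sigma>, handler_nt Q \<sigma>)) hs'),
        list_encode is', list_encode xs', list_encode (map production_encode ps'),
        list_encode (map production_encode rs'), init_state Q, list_encode ms']"
    unfolding program_code_def by blast
  have eqs: "ds = ds'" "is = is'" "xs = xs'" "ps = ps'" "rs = rs'" "ms = ms'"
    "init_state P = init_state Q"
    and m: "map (\<lambda>\<sigma>. prod_encode (\<sigma>, handler_nt P \<sigma>)) hs =
      map (\<lambda>\<sigma>. prod_encode (\<sigma>, handler_nt Q \<sigma>)) hs'"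
    using trans[OF p(8)[symmetric] q(8)] unfolding list_encode_eq by (simp_all add: inj list_encode_eq)
  from m have hs: "hs = hs'"
    by (auto simp: list_eq_iff_nth_eq)
  with m have nt: "\<forall>\<sigma> \<in> handlers P. handler_nt P \<sigma> = handler_nt Q \<sigma>"
    using p(2) by auto
  have "handler_nt P = handler_nt Q"
  proof (rule extensionalityI)
    show "handler_nt P \<in> extensional (handlers P)"
      using assms(1) by (auto simp: async_program_def PiE_def)
    show "handler_nt Q \<in> extensional (handlers P)"
      using assms(2) unfolding p(2)[symmetric] hs q(2) by (auto simp: async_program_def PiE_def)
  qed (use nt in blast)
  moreover have "states P = states Q" "handlers P = handlers Q" "internals P = internals Q"
    "nonterminals P = nonterminals Q" "cfg_prods P = cfg_prods Q" "reg_prods P = reg_prods Q"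
    "init_pending P = init_pending Q"
    by (simp_all only: p(1-7)[symmetric] q(1-7)[symmetric] eqs hs)
  ultimately show ?thesis using eqs(7) by (intro acp.equality) simp_all
qed

end

theory Submission
  imports Defs "HOL-Library.Countable"
begin

text \<open>A handler can reset counters and, in a single step, post arbitrarily many tokens, so a program
  can guess a budget \<open>N\<close> and simulate a counter machine inside that budget over and over again, taking
  a reset for a zero test. Every step consumes one token and posts one, so each reset of a nonempty
  counter, that is, each wrong zero test, loses tokens for good. An infinite run therefore restarts
  infinitely often and errs finitely often, which means that the machine halts; conversely, if it
  halts, a sufficiently large budget allows it to be restarted for ever.

  The machine applies an alleged decision procedure to the code of the very program that
  simulates it and halts iff the answer is 0. It gets hold of that code because its input \<open>a\<close>, which is
  loaded by a chain of control states, is the code of all productions outside this chain; the chain itself is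
  computed from \<open>a\<close>. Restarting loads the input from the control states, not from tokens,
  since tokens may have been lost.\<close>

section \<open>Loop programs\<close>

text \<open>A reduction from the halting problem would ask for a computable translation of arbitrary
  machines into grammars. The diagonal argument asks much less of the recursive functions: they only
  prepend the productions of a chain to a list whose code is \<open>a\<close>. The knot is not
  circular, because the machine depends only on the alleged procedure and on this function; the
  register bound, the constant productions and \<open>a\<close> are determined from it afterwards.
  Since a list code is at least as large as all numbers in it, \<open>a\<close> also bounds the
  states and letters of the program, whose remaining components can then be initial segments of the
  numbers.

  The obstacle in the net is a diverging simulation that never loses a token. It is excluded by the
  difference between free and spent budget: spent tokens become free again only after the simulated
  machine has reached its end, so every round is finite.\<close>

datatype instr = Inc nat | Loop nat "instr list"

text \<open>Entering a loop tests and decrements in one step, because consuming a token does exactly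
  this. The body may increase \<open>r\<close> again, so \<open>Loop\<close> is a while loop and
  allows unbounded search.\<close>

inductive mstep :: "instr list \<times> (nat \<Rightarrow> nat) \<Rightarrow> instr list \<times> (nat \<Rightarrow> nat) \<Rightarrow> bool" where
  mstep_Inc: "mstep (Inc r # K, s) (K, s(r := Suc (s r)))"
| mstep_exit: "s r = 0 \<Longrightarrow> mstep (Loop r b # K, s) (K, s)"
| mstep_enter: "s r = Suc k \<Longrightarrow> mstep (Loop r b # K, s) (b @ Loop r b # K, s(r := k))"

inductive_cases mstep_NilE: "mstep ([], s) c"
inductive_cases mstep_IncE: "mstep (Inc r # K, s) c"
inductive_cases mstep_LoopE: "mstep (Loop r b # K, s) c"

lemma mstep_deterministic: "mstep c d \<Longrightarrow> mstep c e \<Longrightarrow> d = e"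
  by (induction rule: mstep.induct) (auto elim: mstep_IncE mstep_LoopE)

text \<open>Determinism puts every reachable configuration on the way to the final one. Used
  contrapositively: reaching a diverging configuration refutes halting.\<close>

lemma mstep_confluent:
  assumes "mstep\<^sup>*\<^sup>* c d" "mstep\<^sup>*\<^sup>* c ([], t)"
  shows "mstep\<^sup>*\<^sup>* d ([], t)"
  using assms
proof (induction rule: rtranclp_induct)
  case (step y z)
  from step.IH[OF step.prems] show ?case
  proof (cases rule: converse_rtranclpE)
    case base
    with step.hyps(2) show ?thesis by (auto elim: mstep_NilE)
  next
    case (step w)
    with \<open>mstep y z\<close> show ?thesis using mstep_deterministic by blast
  qed
qed

text \<open>Quantifying over the continuation \<open>K\<close> makes such statements compose, in
  sequence and inside a loop body, where \<open>K\<close> starts with the loop itself.\<close>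

definition runs :: "instr list \<Rightarrow> (nat \<Rightarrow> nat) \<Rightarrow> (nat \<Rightarrow> nat) \<Rightarrow> bool" where
  "runs p s t \<longleftrightarrow> (\<forall>K. mstep\<^sup>*\<^sup>* (p @ K, s) (K, t))"

lemma runs_Nil: "runs [] s s"
  by (simp add: runs_def)

lemma runs_append: "runs p s t \<Longrightarrow> runs q t u \<Longrightarrow> runs (p @ q) s u"
  unfolding runs_def by (metis append_assoc rtranclp_trans)

lemma runs_Cons: "runs [i] s t \<Longrightarrow> runs q t u \<Longrightarrow> runs (i # q) s u"
  using runs_append[of "[i]"] by simp

lemma runs_Inc: "runs [Inc r] s (s(r := Suc (s r)))"
  by (auto simp: runs_def intro: mstep.intros)

lemma runs_Loop_exit: "s r = 0 \<Longrightarrow> runs [Loop r b] s s"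
  by (auto simp: runs_def intro: mstep.intros)

lemma runs_Loop_enter:
  assumes "s r = Suc k" "runs b (s(r := k)) t" "runs [Loop r b] t u"
  shows "runs [Loop r b] s u"
  unfolding runs_def
proof
  fix K
  have "mstep ([Loop r b] @ K, s) (b @ [Loop r b] @ K, s(r := k))"
    using mstep_enter[where r = r and s = s and k = k, OF assms(1)] by simp
  also have "mstep\<^sup>*\<^sup>* \<dots> ([Loop r b] @ K, t)" using assms(2) by (simp add: runs_def)
  also have "mstep\<^sup>*\<^sup>* \<dots> (K, u)" using assms(3) by (simp add: runs_def)
  finally show "mstep\<^sup>*\<^sup>* ([Loop r b] @ K, s) (K, u)" .
qed

lemma runs_clear: "runs [Loop r []] s (s(r := 0))"
proof (induction "s r" arbitrary: s)
  case 0
  then show ?case using runs_Loop_exit[of s r] by (simp add: fun_upd_idem)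
next
  case (Suc k)
  from Suc(1)[of "s(r := k)"] have "runs [Loop r []] (s(r := k)) (s(r := 0))" by simp
  with runs_Loop_enter[where s = s and r = r and k = k, OF _ runs_Nil] Suc(2) show ?case by simp
qed

lemma runs_move:
  assumes "r \<noteq> q"
  shows "runs [Loop r [Inc q]] s (s(q := s q + s r, r := 0))"
proof (induction "s r" arbitrary: s)
  case 0
  then show ?case using runs_Loop_exit[of s r] by (simp add: fun_upd_idem)
next
  case (Suc k)
  let ?t = "s(r := k, q := Suc (s q))"
  have "runs [Inc q] (s(r := k)) ?t"
    using runs_Inc[of q "s(r := k)"] assms by simp
  moreover have "runs [Loop r [Inc q]] ?t (?t(q := ?t q + ?t r, r := 0))"
    using Suc(1)[of ?t] assms by simp
  moreover have "?t(q := ?t q + ?t r, r := 0) = s(q := s q + s r, r := 0)"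
    using assms Suc(2) by (auto simp: fun_eq_iff)
  ultimately show ?case using Suc(2)[symmetric] by (metis runs_Loop_enter)
qed

lemma runs_fork:
  assumes "r \<noteq> q" "r \<noteq> t" "q \<noteq> t"
  shows "runs [Loop r [Inc q, Inc t]] s (s(q := s q + s r, t := s t + s r, r := 0))"
proof (induction "s r" arbitrary: s)
  case 0
  then show ?case using runs_Loop_exit[of s r] by (simp add: fun_upd_idem)
next
  case (Suc k)
  let ?t = "s(r := k, q := Suc (s q), t := Suc (s t))"
  have "runs [Inc q, Inc t] (s(r := k)) ?t"
    using runs_Cons[OF runs_Inc[of q "s(r := k)"] runs_Inc[of t]] assms by simp
  moreover have "runs [Loop r [Inc q, Inc t]] ?t (?t(q := ?t q + ?t r, t := ?t t + ?t r, r := 0))"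
    using Suc(1)[of ?t] assms by simp
  moreover have "?t(q := ?t q + ?t r, t := ?t t + ?t r, r := 0)
      = s(q := s q + s r, t := s t + s r, r := 0)"
    using assms Suc(2) by (auto simp: fun_eq_iff)
  ultimately show ?case using Suc(2)[symmetric] by (metis runs_Loop_enter)
qed

text \<open>A loop destroys its counter, so a copy fills two registers and moves one of them
  back.\<close>

lemma runs_copy:
  assumes "r \<noteq> q" "r \<noteq> t" "q \<noteq> t" "s t = 0"
  shows "runs [Loop r [Inc q, Inc t], Loop t [Inc r]] s (s(q := s q + s r))"
proof -
  let ?u = "s(q := s q + s r, t := s t + s r, r := 0)"
  have "?u(r := ?u r + ?u t, t := 0) = s(q := s q + s r)"
    using assms by (auto simp: fun_eq_iff)
  with runs_move[of t r ?u] have "runs [Loop t [Inc r]] ?u (s(q := s q + s r))"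
    using assms by simp
  with runs_fork[OF assms(1-3)] show ?thesis by (rule runs_Cons)
qed

lemma runs_clear_list: "runs (map (\<lambda>r. Loop r []) rs) s (\<lambda>r. if r \<in> set rs then 0 else s r)"
proof (induction rs arbitrary: s)
  case Nil
  then show ?case by (simp add: runs_Nil)
next
  case (Cons x rs)
  have "(\<lambda>r. if r \<in> set rs then 0 else (s(x := 0)) r) = (\<lambda>r. if r \<in> set (x # rs) then 0 else s r)"
    by (auto simp: fun_eq_iff)
  with runs_Cons[OF runs_clear Cons, of x s] show ?case by (simp only: list.map)
qed

section \<open>Loop programs compute partial recursive functions\<close>

text \<open>The arguments are left intact, the result is added to the empty register \<open>out\<close>, and the
  registers from \<open>n\<close> on are scratch space that is empty before and after the run.\<close>

definition implements :: "recf \<Rightarrow> instr list \<Rightarrow> nat list \<Rightarrow> nat \<Rightarrow> nat \<Rightarrow> bool" where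
  "implements f p args out n \<longleftrightarrow>
     (\<forall>s y. rec_eval f (map s args) y \<longrightarrow> s out = 0 \<longrightarrow> (\<forall>r\<ge>n. s r = 0) \<longrightarrow> runs p s (s(out := y)))"

lemma implementsD:
  "implements f p args out n \<Longrightarrow> rec_eval f (map s args) y \<Longrightarrow> s out = 0 \<Longrightarrow>
    (\<And>r. r \<ge> n \<Longrightarrow> s r = 0) \<Longrightarrow> runs p s (s(out := y))"
  by (auto simp: implements_def)

text \<open>The results go to consecutive registers. Raising the scratch bound from \<open>j\<close>
  to \<open>Suc j\<close> after each program protects the result in \<open>j\<close> from the later
  ones.\<close>

lemma implements_list_exists:
  assumes "\<And>g args out n. g \<in> set gs \<Longrightarrow> set args \<subseteq> {..<n} \<Longrightarrow> out < n \<Longrightarrow> out \<notin> set args \<Longrightarrow>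
      \<exists>p. implements g p args out n"
    and "set args \<subseteq> {..<j}"
  shows "\<exists>p. \<forall>s ys. list_all2 (\<lambda>g y. rec_eval g (map s args) y) gs ys \<longrightarrow> (\<forall>r\<ge>j. s r = 0) \<longrightarrow>
    runs p s (\<lambda>r. if j \<le> r \<and> r < j + length ys then ys ! (r - j) else s r)"
  using assms
proof (induction gs arbitrary: j)
  case Nil
  have "(\<lambda>r. if j \<le> r \<and> r < j + 0 then ys ! (r - j) else s r) = s" for s :: "nat \<Rightarrow> nat" and ys
    by auto
  then have "runs [] s (\<lambda>r. if j \<le> r \<and> r < j + 0 then ys ! (r - j) else s r)" for s :: "nat \<Rightarrow> nat" and ys
    by (simp only: runs_Nil)
  then show ?case by (intro exI[of _ "[]"]) (simp only: list_all2_Nil list.size simp_thms)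
next
  case (Cons g gs)
  have args: "set args \<subseteq> {..<Suc j}" "j \<notin> set args" using Cons.prems(2) by auto
  obtain p where p: "implements g p args j (Suc j)"
    using Cons.prems(1)[of g args "Suc j" j] args by auto
  obtain q where q: "\<And>s ys. list_all2 (\<lambda>g y. rec_eval g (map s args) y) gs ys \<Longrightarrow> (\<forall>r\<ge>Suc j. s r = 0) \<Longrightarrow>
    runs q s (\<lambda>r. if Suc j \<le> r \<and> r < Suc j + length ys then ys ! (r - Suc j) else s r)"
    using Cons.IH[OF Cons.prems(1) args(1)] by auto
  show ?case
  proof (intro exI allI impI)
    fix s ys
    assume "list_all2 (\<lambda>g y. rec_eval g (map s args) y) (g # gs) ys" and z: "\<forall>r\<ge>j. s r = 0"
    then obtain y zs where ys: "ys = y # zs" "rec_eval g (map s args) y"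
      "list_all2 (\<lambda>g y. rec_eval g (map s args) y) gs zs"
      by (auto simp: list_all2_Cons1)
    let ?t = "s(j := y)"
    have pt: "runs p s ?t" using implementsD[OF p ys(2)] z by auto
    have "map ?t args = map s args" using args(2) by auto
    with q[of ?t zs] ys(3) z
    have "runs q ?t (\<lambda>r. if Suc j \<le> r \<and> r < Suc j + length zs then zs ! (r - Suc j) else ?t r)"
      by auto
    with pt have "runs (p @ q) s (\<lambda>r. if Suc j \<le> r \<and> r < Suc j + length zs then zs ! (r - Suc j) else ?t r)"
      by (rule runs_append)
    also have "(\<lambda>r. if Suc j \<le> r \<and> r < Suc j + length zs then zs ! (r - Suc j) else ?t r)
        = (\<lambda>r. if j \<le> r \<and> r < j + length ys then ys ! (r - j) else s r)"
    proof
      fix r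
      consider "r < j" | "r = j" | k where "r = Suc j + k"
        by (metis le_Suc_ex linorder_neqE_nat Suc_leI)
      then show "(if Suc j \<le> r \<and> r < Suc j + length zs then zs ! (r - Suc j) else ?t r)
          = (if j \<le> r \<and> r < j + length ys then ys ! (r - j) else s r)"
        by cases (simp_all add: ys)
    qed
    finally show "runs (p @ q) s (\<lambda>r. if j \<le> r \<and> r < j + length ys then ys ! (r - j) else s r)" .
  qed
qed

lemma implements_Comp:
  assumes gs: "\<And>g args out n. g \<in> set gs \<Longrightarrow> set args \<subseteq> {..<n} \<Longrightarrow> out < n \<Longrightarrow> out \<notin> set args \<Longrightarrow>
      \<exists>p. implements g p args out n"
    and f: "\<And>args out n. set args \<subseteq> {..<n} \<Longrightarrow> out < n \<Longrightarrow> out \<notin> set args \<Longrightarrow> \<exists>p. implements f p args out n"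
    and args: "set args \<subseteq> {..<n}" "out < n" "out \<notin> set args"
  shows "\<exists>p. implements (Comp f gs) p args out n"
proof -
  let ?as = "[n..<n + length gs]"
  obtain p where p: "\<And>s ys. list_all2 (\<lambda>g y. rec_eval g (map s args) y) gs ys \<Longrightarrow> (\<forall>r\<ge>n. s r = 0) \<Longrightarrow>
    runs p s (\<lambda>r. if n \<le> r \<and> r < n + length ys then ys ! (r - n) else s r)"
    using implements_list_exists[OF gs args(1)] that by blast
  have "set ?as \<subseteq> {..<n + length gs}" "out \<notin> set ?as" using args(2) by auto
  then obtain q where q: "implements f q ?as out (n + length gs)"
    using f[of ?as "n + length gs" out] args(2) by auto
  show ?thesis
  proof (rule exI, unfold implements_def, intro allI impI)
    fix s y
    assume "rec_eval (Comp f gs) (map s args) y" and z: "s out = 0" "\<forall>r\<ge>n. s r = 0"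
    then obtain ys where ys: "list_all2 (\<lambda>g y. rec_eval g (map s args) y) gs ys" "rec_eval f ys y"
      by (auto elim: rec_eval_elims)
    have len: "length ys = length gs" using ys(1) by (simp add: list_all2_lengthD)
    let ?t = "\<lambda>r. if n \<le> r \<and> r < n + length ys then ys ! (r - n) else s r"
    have "map ?t ?as = ys" using len by (auto intro!: nth_equalityI)
    then have "runs q ?t (?t(out := y))"
      using implementsD[OF q, of ?t y] ys(2) z args(2) len by auto
    with p[OF ys(1) z(2)] have "runs (p @ q) s (?t(out := y))" by (rule runs_append)
    \<comment> \<open>The intermediate values occupy scratch space, which has to be left
      empty.\<close>
    moreover have "(\<lambda>r. if r \<in> set ?as then 0 else (?t(out := y)) r) = s(out := y)"
      using z args(2) len by (auto simp: fun_eq_iff)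
    with runs_clear_list[of ?as "?t(out := y)"]
    have "runs (map (\<lambda>r. Loop r []) ?as) (?t(out := y)) (s(out := y))" by simp
    ultimately show "runs ((p @ q) @ map (\<lambda>r. Loop r []) ?as) s (s(out := y))"
      by (rule runs_append)
  qed
qed

text \<open>A value at a larger argument is built from the values at all smaller ones; hence every
  round of the loop finds the values that it needs.\<close>

lemma rec_eval_PrimRec_below:
  "rec_eval (PrimRec f g) ((i + k) # xs) z \<Longrightarrow> \<exists>y. rec_eval (PrimRec f g) (i # xs) y"
proof (induction k arbitrary: z)
  case (Suc k)
  from Suc.prems show ?case by (auto elim: rec_eval_elims(6) intro: Suc.IH)
qed auto

text \<open>Register \<open>n\<close> holds the recursion index, \<open>out\<close> the current
  value, \<open>n + 1\<close> the number of rounds left and \<open>n + 2\<close> the value just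
  computed by \<open>g\<close>. The recursion argument is copied to \<open>n + 1\<close>, since its
  own register must survive.\<close>

lemma implements_PrimRec:
  assumes f: "\<And>args out n. set args \<subseteq> {..<n} \<Longrightarrow> out < n \<Longrightarrow> out \<notin> set args \<Longrightarrow> \<exists>p. implements f p args out n"
    and g: "\<And>args out n. set args \<subseteq> {..<n} \<Longrightarrow> out < n \<Longrightarrow> out \<notin> set args \<Longrightarrow> \<exists>p. implements g p args out n"
    and args: "set args \<subseteq> {..<n}" "out < n" "out \<notin> set args"
  shows "\<exists>p. implements (PrimRec f g) p args out n"
proof (cases args)
  case Nil
  have "\<not> rec_eval (PrimRec f g) [] y" for y by (auto elim: rec_eval.cases)
  then show ?thesis by (auto simp: implements_def Nil)
next
  case (Cons x xs)
  obtain p where p: "implements f p xs out n"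
    using f[of xs n out] args Cons by auto
  have "set (n # out # xs) \<subseteq> {..<n + 3}" "n + 2 \<notin> set (n # out # xs)" using args Cons by auto
  then obtain q where q: "implements g q (n # out # xs) (n + 2) (n + 3)"
    using g[of "n # out # xs" "n + 3" "n + 2"] by auto
  let ?body = "q @ [Loop out [], Loop (n + 2) [Inc out], Inc n]"
  have loop: "runs [Loop (n + 1) ?body] s (s(n := i + k, out := z, n + 1 := 0))"
    if "rec_eval (PrimRec f g) (i # map s xs) y" "rec_eval (PrimRec f g) ((i + k) # map s xs) z"
      "s n = i" "s out = y" "s (n + 1) = k" "\<forall>r\<ge>n + 2. s r = 0" for s i k y z
    using that
  proof (induction k arbitrary: s i y)
    case 0
    then have "y = z" using rec_eval_deterministic by simp
    with 0 runs_Loop_exit[of s "n + 1"] show ?case by (simp add: fun_upd_idem)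
  next
    case (Suc k)
    have "rec_eval (PrimRec f g) ((Suc i + k) # map s xs) z" using Suc.prems(2) by simp
    from rec_eval_PrimRec_below[OF this] obtain y' where y': "rec_eval (PrimRec f g) (Suc i # map s xs) y'" by blast
    then have gy: "rec_eval g (i # y # map s xs) y'"
      using Suc.prems(1) by (auto elim!: rec_eval_elims(6) dest: rec_eval_deterministic)
    let ?s1 = "s(n + 1 := k)"
    let ?s2 = "?s1(n + 2 := y')"
    let ?s3 = "s(n := Suc i, out := y', n + 1 := k)"
    have xs: "n \<notin> set xs" "n + 1 \<notin> set xs" "out \<notin> set xs" "out < n" using args Cons by auto
    then have map1: "map ?s1 (n # out # xs) = i # y # map s xs" using Suc.prems by auto
    have "runs q ?s1 ?s2"
      using implementsD[OF q, of ?s1 y'] gy Suc.prems unfolding map1 by auto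
    moreover have "runs [Loop out []] ?s2 (?s2(out := 0))" by (rule runs_clear)
    moreover have "runs [Loop (n + 2) [Inc out]] (?s2(out := 0)) (s(out := y', n + 1 := k))"
    proof -
      have "(?s2(out := 0))(out := (?s2(out := 0)) out + (?s2(out := 0)) (n + 2), n + 2 := 0)
          = s(out := y', n + 1 := k)"
        using xs Suc.prems by (auto simp: fun_eq_iff)
      with runs_move[of "n + 2" out "?s2(out := 0)"] xs show ?thesis by simp
    qed
    moreover have "runs [Inc n] (s(out := y', n + 1 := k)) ?s3"
    proof -
      have "(s(out := y', n + 1 := k))(n := Suc ((s(out := y', n + 1 := k)) n)) = ?s3"
        using xs Suc.prems by (auto simp: fun_eq_iff)
      with runs_Inc[of n "s(out := y', n + 1 := k)"] show ?thesis by simp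
    qed
    ultimately have body: "runs ?body ?s1 ?s3" by (meson runs_append runs_Cons)
    have map3: "map ?s3 xs = map s xs" using xs by auto
    have "runs [Loop (n + 1) ?body] ?s3 (?s3(n := Suc i + k, out := z, n + 1 := 0))"
    proof (rule Suc.IH)
      show "rec_eval (PrimRec f g) (Suc i # map ?s3 xs) y'" unfolding map3 by (rule y')
      show "rec_eval (PrimRec f g) ((Suc i + k) # map ?s3 xs) z"
        unfolding map3 using Suc.prems(2) by simp
    qed (use Suc.prems xs in auto)
    moreover have "?s3(n := Suc i + k, out := z, n + 1 := 0) = s(n := i + Suc k, out := z, n + 1 := 0)"
      using xs by (auto simp: fun_eq_iff)
    ultimately show ?case
      using runs_Loop_enter[OF _ body] Suc.prems(5) by metis
  qed
  let ?p = "p @ [Loop x [Inc (n + 1), Inc (n + 2)], Loop (n + 2) [Inc x]] @ [Loop (n + 1) ?body] @ [Loop n []]"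
  show ?thesis
  proof (rule exI, unfold implements_def, intro allI impI)
    fix s y
    assume ev: "rec_eval (PrimRec f g) (map s args) y" and z: "s out = 0" "\<forall>r\<ge>n. s r = 0"
    have xs: "n \<notin> set xs" "n + 1 \<notin> set xs" "n + 2 \<notin> set xs" "out \<notin> set xs" "out < n" "x < n" "x \<noteq> out"
      using args Cons by auto
    obtain y0 where y0: "rec_eval (PrimRec f g) (0 # map s xs) y0"
      using ev rec_eval_PrimRec_below[of f g 0 "s x"] by (auto simp: Cons)
    then have f0: "rec_eval f (map s xs) y0" by (rule rec_eval_elims(5))
    let ?s1 = "s(out := y0)"
    let ?s2 = "?s1(n + 1 := s x)"
    have "runs p s ?s1" using implementsD[OF p f0] z by simp
    moreover have "runs [Loop x [Inc (n + 1), Inc (n + 2)], Loop (n + 2) [Inc x]] ?s1 ?s2"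
      using runs_copy[of x "n + 1" "n + 2" ?s1] xs z by simp
    moreover have "runs [Loop (n + 1) ?body] ?s2 (?s2(n := s x, out := y, n + 1 := 0))"
    proof -
      have "map ?s2 xs = map s xs" using xs by auto
      then show ?thesis using loop[of 0 ?s2 y0 "s x" y] y0 ev Cons xs z by auto
    qed
    moreover have "runs [Loop n []] (?s2(n := s x, out := y, n + 1 := 0)) (s(out := y))"
    proof -
      have "(?s2(n := s x, out := y, n + 1 := 0))(n := 0) = s(out := y)"
        using xs z by (auto simp: fun_eq_iff)
      with runs_clear[of n "?s2(n := s x, out := y, n + 1 := 0)"] show ?thesis by simp
    qed
    ultimately show "runs ?p s (s(out := y))" by (meson runs_append)
  qed
qed

text \<open>\<open>out\<close> is the candidate and \<open>n\<close> the value of \<open>f\<close>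
  there. \<open>Loop n\<close> merely tests this value: its body clears what is left of
  \<open>n\<close> before it turns to the next candidate.\<close>

lemma implements_Mu:
  assumes f: "\<And>args out n. set args \<subseteq> {..<n} \<Longrightarrow> out < n \<Longrightarrow> out \<notin> set args \<Longrightarrow> \<exists>p. implements f p args out n"
    and args: "set args \<subseteq> {..<n}" "out < n" "out \<notin> set args"
  shows "\<exists>p. implements (Mu f) p args out n"
proof -
  have "set (out # args) \<subseteq> {..<Suc n}" "n \<notin> set (out # args)" using args by auto
  then obtain p where p: "implements f p (out # args) n (Suc n)"
    using f[of "out # args" "Suc n" n] by auto
  let ?L = "Loop n (Loop n [] # Inc out # p)"
  show ?thesis
  proof (rule exI, unfold implements_def, intro allI impI)
    fix s y
    assume "rec_eval (Mu f) (map s args) y" and z: "s out = 0" "\<forall>r\<ge>n. s r = 0"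
    then have y: "rec_eval f (y # map s args) 0" "\<And>i. i < y \<Longrightarrow> \<exists>v. rec_eval f (i # map s args) (Suc v)"
      by (auto elim: rec_eval_elims(7))
    have map: "map (s(out := i)) (out # args) = i # map s args" for i using args by auto
    have step: "runs p (s(out := i)) (s(out := i, n := v))" if "rec_eval f (i # map s args) v" for i v
      using implementsD[OF p, of "s(out := i)" v] that z args unfolding map by auto
    have loop: "runs [?L] (s(out := i, n := v)) (s(out := y))"
      if "rec_eval f (i # map s args) v" "i + k = y" for i v k
      using that
    proof (induction k arbitrary: i v)
      case 0
      then have v: "v = 0" using y(1) rec_eval_deterministic by simp
      then have "s(out := i, n := v) = s(out := y)" using 0 z args by (auto simp: fun_eq_iff)
      moreover have "(s(out := i, n := v)) n = 0" by (simp add: v)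
      ultimately show ?case using runs_Loop_exit by metis
    next
      case (Suc k)
      then obtain w where "rec_eval f (i # map s args) (Suc w)" using y(2)[of i] by auto
      then have v: "v = Suc w" using Suc.prems(1) rec_eval_deterministic by blast
      obtain u where u: "rec_eval f (Suc i # map s args) u"
      proof (cases "Suc i = y")
        case True
        then show ?thesis using y(1) that by blast
      next
        case False
        then have "Suc i < y" using Suc.prems(2) by simp
        then show ?thesis using y(2) that by blast
      qed
      have "(s(out := i, n := w))(n := 0) = s(out := i)" using z args by (auto simp: fun_eq_iff)
      with runs_clear[of n "s(out := i, n := w)"] have "runs [Loop n []] (s(out := i, n := w)) (s(out := i))"
        by simp
      moreover have "runs [Inc out] (s(out := i)) (s(out := Suc i))" using runs_Inc[of out "s(out := i)"] by simp
      ultimately have "runs (Loop n [] # Inc out # p) (s(out := i, n := w)) (s(out := Suc i, n := u))"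
        using step[OF u] by (meson runs_Cons)
      moreover have "runs [?L] (s(out := Suc i, n := u)) (s(out := y))"
        by (rule Suc.IH[OF u]) (use Suc.prems(2) in simp)
      ultimately have "runs [?L] (s(out := i, n := Suc w)) (s(out := y))"
        using runs_Loop_enter[of "s(out := i, n := Suc w)" n w] by simp
      then show ?case unfolding v .
    qed
    obtain v where v: "rec_eval f (0 # map s args) v" using y by (cases y) auto
    have "runs p s (s(out := 0, n := v))" using step[OF v] z by (simp add: fun_upd_idem)
    moreover have "runs [?L] (s(out := 0, n := v)) (s(out := y))" using loop[OF v] by simp
    ultimately show "runs (p @ [?L]) s (s(out := y))" by (rule runs_append)
  qed
qed

theorem implements_exists:
  "set args \<subseteq> {..<n} \<Longrightarrow> out < n \<Longrightarrow> out \<notin> set args \<Longrightarrow> \<exists>p. implements f p args out n"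
proof (induction f arbitrary: args out n)
  case Zero
  have "implements Zero [] args out n"
    by (auto simp: implements_def fun_upd_idem runs_Nil elim: rec_eval_elims)
  then show ?case ..
next
  case Succ
  show ?case
  proof (cases "length args = 1")
    case True
    then obtain x where x: "args = [x]" by (auto simp: length_Suc_conv)
    have "implements Succ ([Loop x [Inc out, Inc n], Loop n [Inc x]] @ [Inc out]) args out n"
      unfolding implements_def
    proof (intro allI impI)
      fix s y
      assume "rec_eval Succ (map s args) y" "s out = 0" "\<forall>r\<ge>n. s r = 0"
      moreover from this have "y = Suc (s x)" by (auto simp: x elim: rec_eval_elims)
      ultimately show "runs ([Loop x [Inc out, Inc n], Loop n [Inc x]] @ [Inc out]) s (s(out := y))"
        using runs_append[OF runs_copy runs_Inc, of x out n s out] Succ x by auto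
    qed
    then show ?thesis ..
  next
    case False
    then have "\<not> rec_eval Succ (map s args) y" for s :: "nat \<Rightarrow> nat" and y
      by (auto elim: rec_eval_elims)
    then show ?thesis by (auto simp: implements_def)
  qed
next
  case (Proj i)
  have "implements (Proj i) [Loop (args ! i) [Inc out, Inc n], Loop n [Inc (args ! i)]] args out n"
    unfolding implements_def
  proof (intro allI impI)
    fix s y
    assume "rec_eval (Proj i) (map s args) y" and z: "s out = 0" "\<forall>r\<ge>n. s r = 0"
    then have i: "i < length args" "y = s (args ! i)" by (auto elim: rec_eval_elims)
    then have "args ! i \<in> set args" by simp
    then have "args ! i \<noteq> out" "args ! i < n" using Proj by (metis, blast)
    then show "runs [Loop (args ! i) [Inc out, Inc n], Loop n [Inc (args ! i)]] s (s(out := y))"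
      using runs_copy[of "args ! i" out n s] z i Proj by simp
  qed
  then show ?case ..
next
  case (Comp f gs)
  then show ?case by (intro implements_Comp) blast+
next
  case (PrimRec f g)
  then show ?case by (intro implements_PrimRec) blast+
next
  case (Mu f)
  then show ?case by (intro implements_Mu) blast+
qed

section \<open>Halting of loop programs\<close>

definition halts :: "instr list \<Rightarrow> nat \<Rightarrow> bool" where
  "halts p x \<longleftrightarrow> (\<exists>t. mstep\<^sup>*\<^sup>* (p, (\<lambda>_. 0)(0 := x)) ([], t))"

lemma busy_loop_diverges:
  assumes "mstep\<^sup>*\<^sup>* ([Loop r [Inc r]], s) c" "s r > 0"
  shows "fst c \<noteq> []"
proof -
  from assms(1) have "fst c = [Loop r [Inc r]] \<and> snd c r > 0 \<or> fst c = [Inc r, Loop r [Inc r]]"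
  proof (induction rule: rtranclp_induct)
    case base
    then show ?case using assms(2) by simp
  next
    case (step y z)
    then show ?case by (cases y) (auto elim: mstep_IncE mstep_LoopE)
  qed
  then show ?thesis by auto
qed

text \<open>Once \<open>f\<close> has a value on \<open>x\<close>, the final loop is entered for ever unless that value is 0.
  Since the machine is deterministic, the divergence of \<open>f\<close> need not be analysed.\<close>

theorem program_halts_iff_zero:
  "\<exists>p. \<forall>x y. rec_eval f [x] y \<longrightarrow> (halts p x \<longleftrightarrow> y = 0)"
proof -
  obtain p where p: "implements f p [0] 1 2"
    using implements_exists[of "[0]" 2 1 f] by auto
  let ?q = "p @ [Loop 1 [Inc 1]]"
  have "halts ?q x \<longleftrightarrow> y = 0" if "rec_eval f [x] y" for x y
  proof -
    let ?s = "(\<lambda>_. 0)(0 := x)"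
    have r: "mstep\<^sup>*\<^sup>* (?q, ?s) ([Loop 1 [Inc 1]], ?s(1 := y))"
      using implementsD[OF p, of ?s y] that by (auto simp: runs_def)
    show ?thesis
    proof (cases y)
      case 0
      then have "mstep ([Loop 1 [Inc 1]], ?s(1 := y)) ([], ?s(1 := y))" by (auto intro: mstep.intros)
      with r 0 show ?thesis unfolding halts_def by (meson rtranclp.rtrancl_into_rtrancl)
    next
      case (Suc k)
      have "\<not> mstep\<^sup>*\<^sup>* (?q, ?s) ([], t)" for t
        using mstep_confluent[OF r, of t] busy_loop_diverges[of 1 "?s(1 := y)" "([], t)"] Suc by auto
      then show ?thesis using Suc by (auto simp: halts_def)
    qed
  qed
  then show ?thesis by blast
qed

section \<open>Reset nets simulating loop programs\<close>

text \<open>A superset of the instruction lists that a run can meet, finite because it follows the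
  syntax and ignores register values. It provides the control states of the net.\<close>

fun conts :: "instr list \<Rightarrow> instr list set" where
  "conts [] = {[]}"
| "conts (Inc r # K) = insert (Inc r # K) (conts K)"
| "conts (Loop r b # K) = (\<lambda>L. L @ Loop r b # K) ` conts b \<union> conts K"

lemma finite_conts: "finite (conts p)"
  by (induction p rule: conts.induct) auto

lemma Nil_in_conts: "[] \<in> conts p"
  by (induction p rule: conts.induct) auto

lemma self_in_conts: "p \<in> conts p"
proof (induction p rule: conts.induct)
  case (3 r b K)
  then show ?case using image_eqI[OF _ Nil_in_conts, of "Loop r b # K" "\<lambda>L. L @ Loop r b # K" b] by simp
qed auto

lemma mstep_append:
  assumes "mstep (L @ K, s) (M, t)" "L \<noteq> []"
  obtains L' where "mstep (L, s) (L', t)" "M = L' @ K"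
proof -
  obtain i L0 where L: "L = i # L0" using assms(2) by (cases L) auto
  from assms(1) have "\<exists>L'. mstep (L, s) (L', t) \<and> M = L' @ K"
  proof (cases rule: mstep.cases)
    case (mstep_Inc r)
    then show ?thesis using L by (auto intro: mstep.intros)
  next
    case (mstep_exit r b)
    then show ?thesis using L by (auto intro: mstep.intros)
  next
    case (mstep_enter r k b K')
    then have "mstep (L, s) (b @ Loop r b # L0, t)" using L by (auto intro: mstep.intros)
    then show ?thesis using mstep_enter L by (intro exI[of _ "b @ Loop r b # L0"]) simp
  qed
  then show ?thesis using that by blast
qed

lemma conts_closed: "K \<in> conts p \<Longrightarrow> mstep (K, s) (K', t) \<Longrightarrow> K' \<in> conts p"
proof (induction p arbitrary: K K' rule: conts.induct)
  case 1
  then show ?case by (auto elim: mstep_NilE)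
next
  case (2 r L)
  then show ?case using self_in_conts[of L] by (auto elim!: mstep_IncE)
next
  case (3 r b L)
  show ?case
  proof (cases "K \<in> conts L")
    case True
    with 3 show ?thesis by auto
  next
    case False
    then obtain M where M: "M \<in> conts b" "K = M @ Loop r b # L" using 3(3) by auto
    \<comment> \<open>While \<open>M\<close> is nonempty the step takes place in the loop body; once
      it is used up, the loop itself acts.\<close>
    show ?thesis
    proof (cases "M = []")
      case True
      then show ?thesis using 3(4) M(2) self_in_conts[of L] self_in_conts[of b] by (auto elim!: mstep_LoopE)
    next
      case False
      with 3(4) M(2) obtain M' where "mstep (M, s) (M', t)" "K' = M' @ Loop r b # L"
        by (metis mstep_append)
      with 3(1)[OF M(1)] show ?thesis by auto
    qed
  qed
qed

definition register_bound :: "instr list \<Rightarrow> nat \<Rightarrow> bool" where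
  "register_bound p n \<longleftrightarrow> 0 < n \<and> (\<forall>r K. Inc r # K \<in> conts p \<longrightarrow> r < n) \<and>
     (\<forall>r b K. Loop r b # K \<in> conts p \<longrightarrow> r < n)"

lemma register_boundD:
  assumes "register_bound p n"
  shows "0 < n" "Inc r # K \<in> conts p \<Longrightarrow> r < n" "Loop r b # K \<in> conts p \<Longrightarrow> r < n"
  using assms by (auto simp: register_bound_def simp del: ex_simps all_simps)

lemma register_bound_exists:
  obtains n where "register_bound p n"
proof -
  let ?h = "\<lambda>K. case K of Inc r # _ \<Rightarrow> r | Loop r _ # _ \<Rightarrow> r | [] \<Rightarrow> 0"
  have "finite (?h ` conts p)" using finite_conts by blast
  then obtain n where n: "\<And>K. K \<in> conts p \<Longrightarrow> ?h K \<le> n" by (auto simp: finite_nat_set_iff_bounded_le)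
  show ?thesis
    by (rule that[of "Suc n"], unfold register_bound_def) (use n in force)
qed

type_synonym word = "(nat, nat) letter list"

text \<open>The pending handlers are tokens: 0 is free budget, 1 is spent budget, 2 is the token that
  starts the program, and the value of register \<open>r\<close> is the number of tokens \<open>r + 3\<close>.
  A rule \<open>(q, \<sigma>, u, q')\<close> consumes a token \<open>\<sigma>\<close> and executes the word \<open>u\<close>.\<close>

datatype node = Init | Entry | Load nat | Run "instr list"

type_synonym rule = "node \<times> nat \<times> word \<times> node"

fun exec :: "word \<Rightarrow> nat multiset \<Rightarrow> nat multiset" where
  "exec [] m = m"
| "exec (Internal i # u) m = exec u m"
| "exec (Post b # u) m = exec u (add_mset b m)"
| "exec (Cancel b # u) m = exec u (filter_mset (\<lambda>x. x \<noteq> b) m)"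

lemma exec_append: "exec (u @ v) m = exec v (exec u m)"
  by (induction u m rule: exec.induct) auto

text \<open>It leaves the registers empty whatever went wrong before, and loses no token exactly
  when they and the spent budget were empty already. The trailing \<open>Post 0\<close> gives back
  the token that the rule consumes.\<close>

definition flush :: "nat \<Rightarrow> word" where
  "flush n = map (\<lambda>r. Cancel (r + 3)) [0..<n] @ [Cancel 1, Post 0]"

lemma exec_flush: "exec (flush n) m = add_mset 0 (filter_mset (\<lambda>x. x = 0 \<or> x = 2 \<or> x \<ge> n + 3) m)"
proof -
  have "exec (map (\<lambda>r. Cancel (r + 3)) [0..<n]) m = filter_mset (\<lambda>x. x < 3 \<or> x \<ge> n + 3) m"
  proof (induction n)
    case 0
    have "filter_mset (\<lambda>x. x < 3 \<or> x \<ge> 3) m = m" by (auto simp: filter_mset_eq_conv)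
    then show ?case by simp
  next
    case (Suc n)
    then show ?case by (auto simp: exec_append filter_filter_mset intro!: filter_mset_cong)
  qed
  then show ?thesis
    by (auto simp: flush_def exec_append filter_filter_mset intro!: filter_mset_cong)
qed

fun cont_rules :: "nat \<Rightarrow> instr list \<Rightarrow> rule list" where
  "cont_rules n [] = (Run [], 0, flush n, Entry) # (Run [], 1, [Post 0], Run []) #
     map (\<lambda>r. (Run [], r + 3, [Post 0], Run [])) [0..<n]"
| "cont_rules n (Inc r # K) = [(Run (Inc r # K), 0, [Post (r + 3)], Run K)]"
| "cont_rules n (Loop r b # K) =
    [(Run (Loop r b # K), 0, [Cancel (r + 3), Post 1], Run K),
     (Run (Loop r b # K), r + 3, [Post 1], Run (b @ Loop r b # K))]"

definition base_rules :: "instr list \<Rightarrow> nat \<Rightarrow> rule set" where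
  "base_rules p n = insert (Load 0, 0, [Post 1], Run p) (\<Union>K \<in> conts p. set (cont_rules n K))"

definition load_rules :: "nat \<Rightarrow> rule set" where
  "load_rules a = insert (Entry, 0, [Post 3], Load a) {(Load (Suc i), 0, [Post 3], Load i) | i. i \<le> a}"

definition rules :: "instr list \<Rightarrow> nat \<Rightarrow> nat \<Rightarrow> rule set" where
  "rules p n a = base_rules p n \<union> load_rules a"

lemma finite_base_rules: "finite (base_rules p n)"
  by (simp add: base_rules_def finite_conts)

lemma cont_rules_cases:
  assumes "(q, \<sigma>, u, q') \<in> set (cont_rules n K)"
  obtains (flush) "K = []" "q = Run []" "\<sigma> = 0" "u = flush n" "q' = Entry"
    | (recycle) "K = []" "q = Run []" "\<sigma> = 1 \<or> (\<exists>r<n. \<sigma> = r + 3)" "u = [Post 0]" "q' = Run []"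
    | (inc) r L where "K = Inc r # L" "q = Run K" "\<sigma> = 0" "u = [Post (r + 3)]" "q' = Run L"
    | (exit) r b L where "K = Loop r b # L" "q = Run K" "\<sigma> = 0" "u = [Cancel (r + 3), Post 1]" "q' = Run L"
    | (enter) r b L where "K = Loop r b # L" "q = Run K" "\<sigma> = r + 3" "u = [Post 1]" "q' = Run (b @ K)"
  using assms by (cases "(n, K)" rule: cont_rules.cases) auto

lemma rules_cases:
  assumes "(q, \<sigma>, u, q') \<in> rules p n a"
  obtains (entry) "q = Entry" "\<sigma> = 0" "u = [Post 3]" "q' = Load a"
    | (load) i where "q = Load (Suc i)" "\<sigma> = 0" "u = [Post 3]" "q' = Load i"
    | (start) "q = Load 0" "\<sigma> = 0" "u = [Post 1]" "q' = Run p"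
    | (flush) "q = Run []" "\<sigma> = 0" "u = flush n" "q' = Entry"
    | (recycle) "q = Run []" "\<sigma> = 1 \<or> (\<exists>r<n. \<sigma> = r + 3)" "u = [Post 0]" "q' = Run []"
    | (inc) r L where "Inc r # L \<in> conts p" "q = Run (Inc r # L)" "\<sigma> = 0" "u = [Post (r + 3)]" "q' = Run L"
    | (exit) r b L where "Loop r b # L \<in> conts p" "q = Run (Loop r b # L)" "\<sigma> = 0"
        "u = [Cancel (r + 3), Post 1]" "q' = Run L"
    | (enter) r b L where "Loop r b # L \<in> conts p" "q = Run (Loop r b # L)" "\<sigma> = r + 3" "u = [Post 1]"
        "q' = Run (b @ Loop r b # L)"
  using assms unfolding rules_def base_rules_def load_rules_def
  by (auto elim!: cont_rules_cases)

section \<open>From infinite net runs to halting\<close>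

definition nstep :: "instr list \<Rightarrow> nat \<Rightarrow> nat \<Rightarrow> node \<times> nat multiset \<Rightarrow> node \<times> nat multiset \<Rightarrow> bool" where
  "nstep p n a c c' \<longleftrightarrow> (\<exists>q \<sigma> u q' m. (q, \<sigma>, u, q') \<in> rules p n a \<and>
     c = (q, add_mset \<sigma> m) \<and> c' = (q', exec u m))"

lemma nstepI: "(q, \<sigma>, u, q') \<in> rules p n a \<Longrightarrow> nstep p n a (q, add_mset \<sigma> m) (q', exec u m)"
  by (auto simp: nstep_def)

definition registers :: "nat \<Rightarrow> nat multiset \<Rightarrow> nat \<Rightarrow> nat" where
  "registers n m = (\<lambda>r. if r < n then count m (r + 3) else 0)"

lemma nstep_size: "nstep p n a c c' \<Longrightarrow> size (snd c') \<le> size (snd c)"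
  by (auto simp: nstep_def exec_flush elim!: rules_cases intro: size_filter_mset_lesseq)

text \<open>Between two flushes the run goes down in this weight: simulating moves tokens from the
  budget to the registers to the spent budget, recycling moves them back.\<close>

definition weight :: "node \<times> nat multiset \<Rightarrow> nat" where
  "weight c = (if fst c = Run [] then \<Sum>x\<in>#snd c. if x = 0 then 0 else 1
     else Suc (\<Sum>x\<in>#snd c. if x = 0 then 3 else if x = 1 then 1 else 2))"

lemma sum_mset_filter_le: "(\<Sum>x\<in>#filter_mset P m. f x) \<le> (\<Sum>x\<in>#m. f x :: nat)"
  by (induction m) auto

lemma sum_mset_le: "(\<And>x. f x \<le> g x) \<Longrightarrow> (\<Sum>x\<in>#m. f x) \<le> (\<Sum>x\<in>#m. g x :: nat)"
  by (induction m) (auto intro: add_mono)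

text \<open>The bound also covers \<open>Run []\<close>, where the weights are smaller, so a target
  \<open>Run L\<close> need not be split according to whether \<open>L\<close> is empty.\<close>

lemma weight_le: "weight (q, m) \<le> Suc (\<Sum>x\<in>#m. if x = 0 then 3 else if x = 1 then 1 else 2)"
  unfolding weight_def by (auto intro!: le_SucI sum_mset_le)

lemma weight_decreases:
  assumes "nstep p n a c c'" "\<not> (fst c = Run [] \<and> fst c' = Entry)"
  shows "weight c' < weight c"
proof -
  obtain q \<sigma> u q' m where r: "(q, \<sigma>, u, q') \<in> rules p n a" and c: "c = (q, add_mset \<sigma> m)" "c' = (q', exec u m)"
    using assms(1) by (auto simp: nstep_def)
  let ?w = "\<lambda>x::nat. if x = 0 then 3 else if x = 1 then 1 else 2 :: nat"
  note le = order_le_less_trans[OF weight_le]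
  from r show ?thesis
  proof (cases rule: rules_cases)
    case (exit r b L)
    have "(\<Sum>x\<in>#filter_mset (\<lambda>x. x \<noteq> r + 3) m. ?w x) \<le> (\<Sum>x\<in>#m. ?w x)" by (rule sum_mset_filter_le)
    then show ?thesis unfolding c exit exec.simps by (intro le) (simp add: weight_def)
  next
    case flush
    then show ?thesis using assms(2) c by simp
  next
    case recycle
    then show ?thesis unfolding c by (auto simp: weight_def)
  next
    case (inc r L)
    show ?thesis unfolding c inc exec.simps by (intro le) (simp add: weight_def)
  next
    case (enter r b L)
    show ?thesis unfolding c enter exec.simps by (intro le) (simp add: weight_def)
  next
    case start
    show ?thesis unfolding c start exec.simps by (intro le) (simp add: weight_def)
  qed (unfold c; simp add: weight_def)+
qed

lemma filter_mset_eq_if_size_eq: "size (filter_mset P m) = size m \<Longrightarrow> filter_mset P m = m"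
proof (induction m)
  case (add x m)
  then show ?case using size_filter_mset_lesseq[of P m] by (cases "P x") auto
qed simp

text \<open>In \<open>Run []\<close> the registers are being recycled, so only the fact of halting
  is kept. The input is \<open>Suc a\<close> because the entry posts one token on its way to
  \<open>Load a\<close>, and \<open>Load i\<close> is followed by \<open>i\<close> more.\<close>

fun sim_inv :: "instr list \<Rightarrow> nat \<Rightarrow> nat \<Rightarrow> node \<times> nat multiset \<Rightarrow> bool" where
  "sim_inv p n a (Init, m) \<longleftrightarrow> False"
| "sim_inv p n a (Entry, m) \<longleftrightarrow> registers n m = (\<lambda>_. 0)"
| "sim_inv p n a (Load i, m) \<longleftrightarrow> i \<le> a \<and> registers n m = (\<lambda>_. 0)(0 := Suc a - i)"
| "sim_inv p n a (Run K, m) \<longleftrightarrow> (if K = [] then halts p (Suc a)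
     else mstep\<^sup>*\<^sup>* (p, (\<lambda>_. 0)(0 := Suc a)) (K, registers n m))"

lemma sim_inv_Run:
  "mstep\<^sup>*\<^sup>* (p, (\<lambda>_. 0)(0 := Suc a)) (K, registers n m) \<Longrightarrow> sim_inv p n a (Run K, m)"
  by (auto simp: halts_def)

lemma sim_inv_flush: "sim_inv p n a (Entry, exec (flush n) m)"
  by (auto simp: exec_flush registers_def)

text \<open>The size hypothesis decides the exit from a loop: a reset that removes no token found
  the register empty, so the zero test was right.\<close>

lemma sim_inv_step:
  assumes "nstep p n a c c'" "size (snd c') = size (snd c)" "sim_inv p n a c"
    and n: "register_bound p n"
  shows "sim_inv p n a c'"
proof -
  obtain q \<sigma> u q' m where r: "(q, \<sigma>, u, q') \<in> rules p n a" and c: "c = (q, add_mset \<sigma> m)" "c' = (q', exec u m)"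
    using assms(1) by (auto simp: nstep_def)
  let ?s = "registers n (add_mset \<sigma> m)"
  from r show ?thesis
  proof (cases rule: rules_cases)
    case entry
    have "registers n (add_mset 3 m) = ?s(0 := Suc (?s 0))"
      using register_boundD(1)[OF n] entry by (auto simp: registers_def fun_eq_iff)
    with assms(3) entry show ?thesis by (auto simp: c)
  next
    case (load i)
    have "registers n (add_mset 3 m) = ?s(0 := Suc (?s 0))"
      using register_boundD(1)[OF n] load by (auto simp: registers_def fun_eq_iff)
    with assms(3) load show ?thesis by (auto simp: c Suc_diff_le)
  next
    case start
    have "registers n (add_mset 1 m) = ?s"
      using start by (auto simp: registers_def fun_eq_iff)
    with assms(3) start show ?thesis unfolding c start exec.simps by (intro sim_inv_Run) simp
  next
    case flush
    then show ?thesis using sim_inv_flush c by simp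
  next
    case recycle
    with assms(3) show ?thesis by (simp add: c)
  next
    case (inc r L)
    have "registers n (add_mset (r + 3) m) = ?s(r := Suc (?s r))"
      using inc register_boundD(2)[OF n inc(1)] by (auto simp: registers_def fun_eq_iff)
    then have "mstep (Inc r # L, ?s) (L, registers n (add_mset (r + 3) m))"
      by (auto intro: mstep.intros)
    moreover have "mstep\<^sup>*\<^sup>* (p, (\<lambda>_. 0)(0 := Suc a)) (Inc r # L, ?s)"
      using assms(3) inc by (simp add: c)
    ultimately show ?thesis unfolding c inc exec.simps by (intro sim_inv_Run) (meson rtranclp.rtrancl_into_rtrancl)
  next
    case (exit r b L)
    have "size (filter_mset (\<lambda>x. x \<noteq> r + 3) m) = size m"
      using assms(2) exit by (simp add: c)
    then have f: "filter_mset (\<lambda>x. x \<noteq> r + 3) m = m" by (rule filter_mset_eq_if_size_eq)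
    have "count (filter_mset (\<lambda>x. x \<noteq> r + 3) m) (r + 3) = 0" by simp
    then have z: "count m (r + 3) = 0" unfolding f .
    have "registers n (add_mset 1 m) = ?s" using exit by (auto simp: registers_def fun_eq_iff)
    moreover have "?s r = 0" using z exit by (simp add: registers_def)
    ultimately have "mstep (Loop r b # L, ?s) (L, registers n (add_mset 1 m))"
      by (auto intro: mstep.intros)
    moreover have "mstep\<^sup>*\<^sup>* (p, (\<lambda>_. 0)(0 := Suc a)) (Loop r b # L, ?s)"
      using assms(3) exit by (simp add: c)
    ultimately show ?thesis unfolding c exit exec.simps f by (intro sim_inv_Run) (meson rtranclp.rtrancl_into_rtrancl)
  next
    case (enter r b L)
    have "?s r = Suc (count m (r + 3))" using enter register_boundD(3)[OF n enter(1)] by (simp add: registers_def)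
    moreover have "registers n (add_mset 1 m) = ?s(r := count m (r + 3))"
      using enter register_boundD(3)[OF n enter(1)] by (auto simp: registers_def fun_eq_iff)
    ultimately have "mstep (Loop r b # L, ?s) (b @ Loop r b # L, registers n (add_mset 1 m))"
      by (auto intro: mstep.intros)
    moreover have "mstep\<^sup>*\<^sup>* (p, (\<lambda>_. 0)(0 := Suc a)) (Loop r b # L, ?s)"
      using assms(3) enter by (simp add: c)
    ultimately show ?thesis unfolding c enter exec.simps by (intro sim_inv_Run) (meson rtranclp.rtrancl_into_rtrancl)
  qed
qed

theorem infinite_net_run_imp_halts:
  assumes step: "\<And>i. nstep p n a (c i) (c (Suc i))" 
    and n: "register_bound p n"
  shows "halts p (Suc a)"
proof -
  let ?flush = "\<lambda>i. fst (c i) = Run [] \<and> fst (c (Suc i)) = Entry"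
  have flush: "\<exists>i\<ge>k. ?flush i" for k
  proof (rule ccontr)
    assume "\<not> ?thesis"
    then have dec: "weight (c (Suc i)) < weight (c i)" if "i \<ge> k" for i
      using weight_decreases[OF step, of i] that by blast
    have "weight (c (k + j)) + j \<le> weight (c k)" for j
    proof (induction j)
      case (Suc j)
      with dec[of "k + j"] show ?case by simp
    qed simp
    from this[of "Suc (weight (c k))"] show False by simp
  qed
  have anti: "size (snd (c j)) \<le> size (snd (c i))" if "i \<le> j" for i j
    using that by (induction rule: dec_induct) (auto intro: order_trans[OF nstep_size[OF step]])
  \<comment> \<open>From \<open>k\<close> on the size is minimal, so no token is lost any
    more.\<close>
  obtain k where "\<And>j. size (snd (c k)) \<le> size (snd (c j))"
    using ex_has_least_nat[of "\<lambda>_. True" 0 "\<lambda>j. size (snd (c j))"] by auto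
  then have const: "size (snd (c j)) = size (snd (c k))" if "k \<le> j" for j
    using anti[OF that] by (simp add: le_antisym)
  \<comment> \<open>One flush past \<open>k\<close> establishes the invariant; a later one starts in
    \<open>Run []\<close>, where the invariant says that the machine halts.\<close>
  obtain i where i: "i \<ge> k" "?flush i" using flush by blast
  obtain j where j: "j \<ge> Suc i" "?flush j" using flush by blast
  have inv: "sim_inv p n a (c (Suc i))"
  proof -
    obtain q \<sigma> u q' m where r: "(q, \<sigma>, u, q') \<in> rules p n a" and
      c: "c i = (q, add_mset \<sigma> m)" "c (Suc i) = (q', exec u m)"
      using step[of i] unfolding nstep_def by blast
    from r show ?thesis
    proof (cases rule: rules_cases)
      case flush
      then show ?thesis using sim_inv_flush c by simp
    qed (use i(2) c in simp_all)
  qed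
  from j(1) have "sim_inv p n a (c j)"
  proof (induction rule: dec_induct)
    case (step l)
    then have "size (snd (c (Suc l))) = size (snd (c l))" 
      using const[of l] const[of "Suc l"] i(1) by simp
    from sim_inv_step[OF assms(1) this step.IH n] show ?case .
  qed (rule inv)
  then show ?thesis using j(2) by (cases "c j") auto
qed


section \<open>From halting to cycles of the net\<close>

lemma add_mset_if_count: "count m x \<noteq> 0 \<Longrightarrow> \<exists>m'. m = add_mset x m'"
  by (meson count_inI multi_member_split)

lemma sim_step:
  assumes "mstep (K, registers n m) (K', s')" "K \<in> conts p" "count m 0 \<ge> Suc b"
    and n: "register_bound p n"
  obtains m' where "nstep p n a (Run K, m) (Run K', m')" "registers n m' = s'" "size m' = size m"
    "count m' 0 \<ge> b"
proof -
  have rule: "(q, \<sigma>, u, q') \<in> rules p n a" if "(q, \<sigma>, u, q') \<in> set (cont_rules n K)" for q \<sigma> u q'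
    using that assms(2) by (auto simp: rules_def base_rules_def)
  obtain m0 where m0: "m = add_mset 0 m0" using add_mset_if_count[of m 0] assms(3) by auto
  have b: "count m0 0 \<ge> b" using assms(3) m0 by simp
  from assms(1) show ?thesis
  proof (cases rule: mstep.cases)
    case (mstep_Inc r)
    have "nstep p n a (Run K, m) (Run K', add_mset (r + 3) m0)"
      using nstepI[OF rule, of "Run K" 0 "[Post (r + 3)]" "Run K'" m0] mstep_Inc m0 by simp
    moreover have "registers n (add_mset (r + 3) m0) = s'"
      using mstep_Inc register_boundD(2)[OF n] assms(2) m0 by (auto simp: registers_def fun_eq_iff)
    ultimately show ?thesis using that m0 b by simp
  next
    case (mstep_exit r L)
    have "r < n" using register_boundD(3)[OF n] assms(2) mstep_exit by auto
    then have "count m0 (r + 3) = 0" using mstep_exit m0 by (simp add: registers_def)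
    then have "filter_mset (\<lambda>x. x \<noteq> r + 3) m0 = m0"
      by (auto simp: filter_mset_eq_conv count_eq_zero_iff)
    then have "nstep p n a (Run K, m) (Run K', add_mset 1 m0)"
      using nstepI[OF rule, of "Run K" 0 "[Cancel (r + 3), Post 1]" "Run K'" m0] mstep_exit m0 by simp
    moreover have "registers n (add_mset 1 m0) = s'"
      using mstep_exit m0 by (auto simp: registers_def fun_eq_iff)
    ultimately show ?thesis using that m0 b by simp
  next
    case (mstep_enter r k L M)
    have r: "r < n" using register_boundD(3)[OF n] assms(2) mstep_enter by auto
    then have "count m (r + 3) = Suc k" using mstep_enter by (simp add: registers_def)
    then obtain m1 where m1: "m = add_mset (r + 3) m1"
      using add_mset_if_count[of m "r + 3"] by auto
    have "nstep p n a (Run K, m) (Run K', add_mset 1 m1)"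
      using nstepI[OF rule, of "Run K" "r + 3" "[Post 1]" "Run K'" m1] mstep_enter m1 by simp
    moreover have "registers n (add_mset 1 m1) = s'"
      using mstep_enter m1 r by (auto simp: registers_def fun_eq_iff)
    moreover have "count m1 0 \<ge> b" using m1 assms(3) by simp
    ultimately show ?thesis using that m1 by simp
  qed
qed

text \<open>Free budget and the tokens that \<open>Run []\<close> can turn into it; the starting
  token 2 is not among them.\<close>

definition proper :: "nat \<Rightarrow> nat multiset \<Rightarrow> bool" where
  "proper n m \<longleftrightarrow> set_mset m \<subseteq> insert 0 (insert 1 {3..<n + 3})"

lemma nstep_proper:
  assumes "nstep p n a c c'" "proper n (snd c)"
    and n: "register_bound p n"
  shows "proper n (snd c')"
proof -
  obtain q \<sigma> u q' m where r: "(q, \<sigma>, u, q') \<in> rules p n a" and c: "c = (q, add_mset \<sigma> m)" "c' = (q', exec u m)"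
    using assms(1) by (auto simp: nstep_def)
  have m: "proper n m" using assms(2) by (simp add: c proper_def)
  from r show ?thesis
    by (cases rule: rules_cases)
      (use m register_boundD[OF n] in \<open>auto simp: c proper_def exec_flush\<close>)
qed

text \<open>\<open>k\<close> counts the steps, each of which takes at most one free token. The
  surplus \<open>b\<close> lets the induction reserve budget for the steps still to come.\<close>

lemma sim_run:
  assumes "mstep\<^sup>*\<^sup>* (p, s) (K, t)"
    and n: "register_bound p n"
  shows "\<exists>k. \<forall>m b. registers n m = s \<longrightarrow> count m 0 \<ge> k + b \<longrightarrow>
    (\<exists>m'. (nstep p n a)\<^sup>*\<^sup>* (Run p, m) (Run K, m') \<and> registers n m' = t \<and> size m' = size m \<and>
      count m' 0 \<ge> b) \<and> K \<in> conts p"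
  using assms(1)
proof (induction "(K, t)" arbitrary: K t rule: rtranclp_induct)
  case base
  then show ?case using self_in_conts by (intro exI[of _ 0]) auto
next
  case (step y)
  obtain L u where y: "y = (L, u)" by (cases y)
  from step.hyps(3)[OF y] obtain k where k: "\<And>m b. registers n m = s \<Longrightarrow> count m 0 \<ge> k + b \<Longrightarrow>
    (\<exists>m'. (nstep p n a)\<^sup>*\<^sup>* (Run p, m) (Run L, m') \<and> registers n m' = u \<and> size m' = size m \<and>
      count m' 0 \<ge> b) \<and> L \<in> conts p" by blast
  show ?case
  proof (intro exI[of _ "Suc k"] allI impI conjI)
    fix m b assume m: "registers n m = s" "count m 0 \<ge> Suc k + b"
    with k[of m "Suc b"] obtain m1 where m1: "(nstep p n a)\<^sup>*\<^sup>* (Run p, m) (Run L, m1)"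
      "registers n m1 = u" "size m1 = size m" "count m1 0 \<ge> Suc b" and L: "L \<in> conts p" by auto
    have st: "mstep (L, registers n m1) (K, t)" using step.hyps(2) y m1(2) by simp
    obtain m2 where m2: "nstep p n a (Run L, m1) (Run K, m2)" "registers n m2 = t"
      "size m2 = size m1" "count m2 0 \<ge> b"
      using sim_step[OF st L m1(4) n, of a] by blast
    have "(nstep p n a)\<^sup>*\<^sup>* (Run p, m) (Run K, m2)"
      using m1(1) m2(1) by (rule rtranclp.rtrancl_into_rtrancl)
    then show "\<exists>m'. (nstep p n a)\<^sup>*\<^sup>* (Run p, m) (Run K, m') \<and> registers n m' = t \<and>
      size m' = size m \<and> count m' 0 \<ge> b"
      using m1(3) m2 by auto
    show "K \<in> conts p" using conts_closed[OF L st] .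
  qed
qed

lemma load_run:
  assumes "count m 0 \<ge> i + b" "0 < n" "i \<le> a"
  shows "\<exists>m'. (nstep p n a)\<^sup>*\<^sup>* (Load i, m) (Load 0, m') \<and>
    registers n m' = (registers n m)(0 := registers n m 0 + i) \<and> size m' = size m \<and> count m' 0 \<ge> b"
  using assms
proof (induction i arbitrary: m)
  case 0
  then show ?case by auto
next
  case (Suc i)
  obtain m0 where m0: "m = add_mset 0 m0"
    using add_mset_if_count[of m 0] Suc.prems(1) by auto
  let ?m = "add_mset 3 m0"
  have "(Load (Suc i), 0, [Post 3], Load i) \<in> rules p n a"
    using Suc.prems(3) by (simp add: rules_def load_rules_def)
  from nstepI[OF this, of m0] have "nstep p n a (Load (Suc i), m) (Load i, ?m)" by (simp add: m0)
  moreover obtain m' where "(nstep p n a)\<^sup>*\<^sup>* (Load i, ?m) (Load 0, m')"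
    "registers n m' = (registers n ?m)(0 := registers n ?m 0 + i)" "size m' = size ?m" "count m' 0 \<ge> b"
    using Suc.IH[of ?m] Suc.prems by (auto simp: m0 simp del: fun_upd_apply)
  moreover have "(registers n ?m)(0 := registers n ?m 0 + i) = (registers n m)(0 := registers n m 0 + Suc i)"
    using \<open>0 < n\<close> by (auto simp: m0 registers_def fun_eq_iff)
  ultimately show ?case by (auto simp: m0 intro: converse_rtranclp_into_rtranclp)
qed

lemma recycle_run:
  assumes "proper n m"
  shows "(nstep p n a)\<^sup>*\<^sup>* (Run [], m) (Run [], replicate_mset (size m) 0)"
  using assms
proof (induction "size m - count m 0" arbitrary: m)
  case 0
  then have "size (filter_mset (\<lambda>x. x = 0) m) = size m"
    by (metis diff_is_0_eq filter_eq_replicate_mset le_antisym size_filter_mset_lesseq size_replicate_mset)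
  then have "filter_mset (\<lambda>x. x = 0) m = m" by (rule filter_mset_eq_if_size_eq)
  moreover have "count m 0 = size m"
    using \<open>size (filter_mset _ m) = size m\<close> by (simp add: filter_eq_replicate_mset)
  ultimately have "m = replicate_mset (size m) 0" by (simp add: filter_eq_replicate_mset)
  then show ?case by (metis rtranclp.rtrancl_refl)
next
  case (Suc k)
  have "\<exists>x \<in># m. x \<noteq> 0"
  proof (rule ccontr)
    assume "\<not> ?thesis"
    then have "filter_mset (\<lambda>x. x = 0) m = m" by (auto simp: filter_mset_eq_conv)
    then have "count m 0 = size m" by (metis filter_eq_replicate_mset size_replicate_mset)
    then show False using Suc(2) by simp
  qed
  then obtain x m0 where x: "x \<noteq> 0" "m = add_mset x m0" by (metis multi_member_split)
  then have "x = 1 \<or> (\<exists>r<n. x = r + 3)" using Suc.prems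
    by (auto simp: proper_def) (metis add.commute add_less_cancel_left le_Suc_ex)
  then have "(Run [], x, [Post 0], Run []) \<in> rules p n a"
    using Nil_in_conts[of p] by (force simp: rules_def base_rules_def)
  from nstepI[OF this, of m0] have "nstep p n a (Run [], m) (Run [], add_mset 0 m0)" by (simp add: x)
  moreover have "(nstep p n a)\<^sup>*\<^sup>* (Run [], add_mset 0 m0) (Run [], replicate_mset (size m) 0)"
    using Suc(1)[of "add_mset 0 m0"] Suc(2) Suc.prems x by (auto simp: proper_def)
  ultimately show ?case by (rule converse_rtranclp_into_rtranclp)
qed

text \<open>All tokens come back as free budget, so a budget that suffices for one round suffices
  for all.\<close>

theorem halts_imp_net_cycle:
  assumes "halts p (Suc a)"
    and n: "register_bound p n"
  shows "\<exists>N. \<forall>m. count m 0 \<ge> N \<longrightarrow> set_mset m \<subseteq> {0, 1} \<longrightarrow>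
    (nstep p n a)\<^sup>+\<^sup>+ (Entry, m) (Entry, replicate_mset (size m) 0)"
proof -
  from assms(1) obtain t where t: "mstep\<^sup>*\<^sup>* (p, (\<lambda>_. 0)(0 := Suc a)) ([], t)" by (auto simp: halts_def)
  obtain k where k: "\<And>m b. registers n m = (\<lambda>_. 0)(0 := Suc a) \<Longrightarrow> count m 0 \<ge> k + b \<Longrightarrow>
    \<exists>m'. (nstep p n a)\<^sup>*\<^sup>* (Run p, m) (Run [], m') \<and> registers n m' = t \<and> size m' = size m \<and>
      count m' 0 \<ge> b"
    using sim_run[OF t n, of a] by (metis (lifting))
  \<comment> \<open>One token for the entry, \<open>a\<close> for the chain, one for the start and
    \<open>k\<close> for the computation.\<close>
  have "(nstep p n a)\<^sup>+\<^sup>+ (Entry, m) (Entry, replicate_mset (size m) 0)"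
    if m: "count m 0 \<ge> Suc (a + Suc k)" "set_mset m \<subseteq> {0, 1}" for m
  proof -
    obtain m0 where m0: "m = add_mset 0 m0"
      using add_mset_if_count[of m 0] m(1) by auto
    have rule: "(Entry, 0, [Post 3], Load a) \<in> rules p n a" "(Load 0, 0, [Post 1], Run p) \<in> rules p n a"
      "(Run [], 0, flush n, Entry) \<in> rules p n a"
      using Nil_in_conts[of p] by (force simp: rules_def load_rules_def base_rules_def)+
    let ?R = "nstep p n a"
    have reg: "registers n (add_mset 3 m0) = (\<lambda>_. 0)(0 := 1)"
      using m(2) register_boundD(1)[OF n] by (auto simp: registers_def fun_eq_iff m0 not_in_iff[symmetric])
    have s1: "?R (Entry, m) (Load a, add_mset 3 m0)" using nstepI[OF rule(1), of m0] by (simp add: m0)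
    obtain m2 where m2: "?R\<^sup>*\<^sup>* (Load a, add_mset 3 m0) (Load 0, m2)"
      "registers n m2 = (\<lambda>_. 0)(0 := Suc a)" "size m2 = size m" "count m2 0 \<ge> Suc k"
      using load_run[of a "Suc k" "add_mset 3 m0" n a p] m(1) register_boundD(1)[OF n] reg by (auto simp: m0)
    obtain m3 where m3: "m2 = add_mset 0 m3"
      using add_mset_if_count[of m2 0] m2(4) by auto
    have s3: "?R (Load 0, m2) (Run p, add_mset 1 m3)" using nstepI[OF rule(2), of m3] by (simp add: m3)
    have "registers n (add_mset 1 m3) = registers n m2" by (auto simp: registers_def m3)
    then obtain m4 where m4: "?R\<^sup>*\<^sup>* (Run p, add_mset 1 m3) (Run [], m4)" "size m4 = size m"
      using k[of "add_mset 1 m3" 0] m2 by (auto simp: m3)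
    have run: "?R\<^sup>*\<^sup>* (Entry, m) (Run [], m4)"
      using s1 m2(1) s3 m4(1) by (meson converse_rtranclp_into_rtranclp rtranclp_trans)
    then have "proper n (snd (Run [], m4))"
    proof (induction rule: rtranclp_induct)
      case base
      then show ?case using m(2) by (auto simp: proper_def)
    next
      case (step y z)
      show ?case by (rule nstep_proper[OF step(2,3) n])
    qed
    then have "?R\<^sup>*\<^sup>* (Run [], m4) (Run [], replicate_mset (size m) 0)"
      using recycle_run[of n m4 p a] m4(2) by simp
    moreover have "?R (Run [], replicate_mset (size m) 0) (Entry, replicate_mset (size m) 0)"
    proof -
      \<comment> \<open>After complete recycling the flush has nothing to remove.\<close>
      have e: "exec (flush n) (replicate_mset (size m0) 0) = replicate_mset (size m) 0"
      proof -
        have "filter_mset (\<lambda>x. x = 0 \<or> x = 2 \<or> x \<ge> n + 3) (replicate_mset (size m0) 0) = replicate_mset (size m0) 0"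
          by (auto simp: filter_mset_eq_conv)
        then show ?thesis by (simp add: exec_flush m0)
      qed
      show ?thesis using nstepI[OF rule(3), of "replicate_mset (size m0) 0"] unfolding e by (simp add: m0)
    qed
    ultimately show ?thesis using run by (meson rtranclp_into_tranclp1 rtranclp_trans)
  qed
  then show ?thesis by blast
qed

section \<open>Asynchronous programs from reset nets\<close>

instance letter :: (countable, countable) countable
  by countable_datatype

instance instr :: countable
  by countable_datatype

instance node :: countable
  by countable_datatype

type_synonym edge = "(word \<times> node) \<times> (nat, nat) letter \<times> (word \<times> node)"

text \<open>In the state \<open>(u, q)\<close> the regular grammar still has to emit \<open>u\<close> before it arrives at \<open>q\<close>.\<close>

fun word_edges :: "word \<Rightarrow> node \<Rightarrow> edge set" where
  "word_edges [] q = {}"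
| "word_edges (x # u) q = insert ((x # u, q), x, (u, q)) (word_edges u q)"

fun rule_edges :: "rule \<Rightarrow> edge set" where
  "rule_edges (q, \<sigma>, u, q') = insert (([], q), Internal \<sigma>, (u, q')) (word_edges u q')"

definition init_rule :: rule where
  "init_rule = (Init, 2, [Post 0, Post 1], Entry)"

text \<open>The loop lets the first step post an arbitrary budget. No other rule passes through the
  state it is attached to.\<close>

definition loop_edge :: edge where
  "loop_edge = (([Post 0, Post 1], Entry), Post 0, ([Post 0, Post 1], Entry))"

definition base_edges :: "instr list \<Rightarrow> nat \<Rightarrow> edge set" where
  "base_edges p n = insert loop_edge (rule_edges init_rule \<union> (\<Union>r\<in>base_rules p n. rule_edges r))"

definition load_edges :: "nat \<Rightarrow> edge set" where
  "load_edges a = (\<Union>r\<in>load_rules a. rule_edges r)"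

section \<open>Edges and paths of the regular grammar\<close>

lemma finite_word_edges: "finite (word_edges u q)"
  by (induction u) auto

lemma finite_base_edges: "finite (base_edges p n)"
proof -
  have "finite (rule_edges r)" for r
    by (cases r) (simp add: finite_word_edges)
  then show ?thesis by (simp add: base_edges_def finite_base_rules)
qed

lemma edges_eq:
  "base_edges p n \<union> load_edges a = insert loop_edge (\<Union>r\<in>insert init_rule (rules p n a). rule_edges r)"
  by (auto simp: base_edges_def load_edges_def rules_def)

lemma edge_cases:
  assumes "e \<in> base_edges p n \<union> load_edges a"
  obtains (loop) "e = loop_edge"
    | (rule) q \<sigma> u q' where "(q, \<sigma>, u, q') \<in> insert init_rule (rules p n a)" "e \<in> rule_edges (q, \<sigma>, u, q')"
  using assms unfolding edges_eq by (metis UN_E insertE prod_cases4)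

lemma rules_word:
  assumes "(q, \<sigma>, u, q') \<in> insert init_rule (rules p n a)"
  shows "Internal i \<notin> set u"
  using assms by (auto simp: init_rule_def flush_def elim!: rules_cases)

lemma word_edges_iff:
  "(x, l, z) \<in> word_edges u q \<longleftrightarrow> snd x = q \<and> snd z = q \<and> fst x = l # fst z \<and> (\<exists>v. u = v @ l # fst z)"
proof (induction u)
  case (Cons y u)
  show ?case
    by (auto simp: Cons.IH Cons_eq_append_conv prod_eq_iff)
qed simp

lemma Internal_edge:
  assumes "(x, Internal \<sigma>, z) \<in> base_edges p n \<union> load_edges a"
  shows "fst x = [] \<and> (snd x, \<sigma>, z) \<in> insert init_rule (rules p n a)"
proof -
  from assms obtain q \<tau> u q' where r: "(q, \<tau>, u, q') \<in> insert init_rule (rules p n a)"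
    "(x, Internal \<sigma>, z) \<in> rule_edges (q, \<tau>, u, q')"
    by (rule edge_cases) (simp add: loop_edge_def)
  moreover have "(x, Internal \<sigma>, z) \<notin> word_edges u q'"
    using rules_word[OF r(1), of \<sigma>] by (auto simp: word_edges_iff)
  ultimately show ?thesis by auto
qed

lemma other_edge:
  assumes "(x, l, z) \<in> base_edges p n \<union> load_edges a" "\<And>i. l \<noteq> Internal i"
  shows "snd z = snd x \<and> (fst x = l # fst z \<or> x = ([Post 0, Post 1], Entry))"
proof -
  from assms(1) show ?thesis
    by (cases rule: edge_cases) (use assms(2) in \<open>auto simp: loop_edge_def word_edges_iff\<close>)
qed

text \<open>Extended at the right end, like a derivation in a right-linear grammar.\<close>

inductive path :: "edge set \<Rightarrow> word \<times> node \<Rightarrow> word \<Rightarrow> word \<times> node \<Rightarrow> bool" for E where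
  path_Nil: "path E x [] x"
| path_snoc: "path E x w y \<Longrightarrow> (y, l, z) \<in> E \<Longrightarrow> path E x (w @ [l]) z"

lemma path_NilD: "path E x [] y \<Longrightarrow> x = y"
  by (auto elim: path.cases)

lemma path_snocD: "path E x (w @ [l]) z \<Longrightarrow> \<exists>y. path E x w y \<and> (y, l, z) \<in> E"
  by (auto elim: path.cases simp del: split_paired_Ex)

lemma path_ConsD: "path E x (l # w) y \<Longrightarrow> \<exists>z. (x, l, z) \<in> E"
proof (induction w arbitrary: y rule: rev_induct)
  case Nil
  then show ?case using path_snocD[of E x "[]" l y] path_NilD by fastforce
next
  case (snoc l' w)
  then show ?case using path_snocD[of E x "l # w" l' y] by auto
qed

lemma path_append: "path E x u y \<Longrightarrow> path E y v z \<Longrightarrow> path E x (u @ v) z"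
proof (induction v arbitrary: z rule: rev_induct)
  case Nil
  then show ?case by (auto dest: path_NilD)
next
  case (snoc l v)
  then obtain z' where "path E y v z'" "(z', l, z) \<in> E" by (auto dest: path_snocD)
  with snoc have "path E x ((u @ v) @ [l]) z" by (intro path_snoc)
  then show ?case by simp
qed

lemma path_edge: "(x, l, z) \<in> E \<Longrightarrow> path E x [l] z"
  using path_snoc[where w = "[]" and x = x and y = x and l = l and z = z, OF path_Nil] by simp

lemma path_word: "word_edges u q \<subseteq> E \<Longrightarrow> path E (u, q) u ([], q)"
proof (induction u)
  case Nil
  show ?case by (rule path_Nil)
next
  case (Cons x u)
  then show ?case using path_append[OF path_edge[of "(x # u, q)" x "(u, q)" E]] by simp
qed

lemma path_rule:
  assumes "rule_edges (q, \<sigma>, u, q') \<subseteq> E"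
  shows "path E ([], q) (Internal \<sigma> # u) ([], q')"
proof -
  have "path E ([], q) [Internal \<sigma>] (u, q')" using assms by (intro path_edge) auto
  moreover have "path E (u, q') u ([], q')" using assms by (intro path_word) auto
  ultimately have "path E ([], q) ([Internal \<sigma>] @ u) ([], q')" by (rule path_append)
  then show ?thesis by simp
qed

lemma path_init: "path (base_edges p n \<union> load_edges a) ([], Init)
    (Internal 2 # replicate k (Post 0) @ [Post 0, Post 1]) ([], Entry)"
proof -
  let ?E = "base_edges p n \<union> load_edges a" and ?x = "([Post 0, Post 1], Entry) :: word \<times> node"
  have init: "rule_edges init_rule \<subseteq> ?E" and loop: "loop_edge \<in> ?E" by (auto simp: base_edges_def)
  have "path ?E ([], Init) [Internal 2] ?x" using init by (intro path_edge) (auto simp: init_rule_def)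
  moreover have "path ?E ?x (replicate k (Post 0)) ?x"
  proof (induction k)
    case (Suc k)
    with loop have "path ?E ?x (replicate k (Post 0) @ [Post 0]) ?x"
      unfolding loop_edge_def by (intro path_snoc)
    then show ?case by (simp add: replicate_append_same)
  qed (simp add: path_Nil)
  moreover have "path ?E ?x [Post 0, Post 1] ([], Entry)"
    using init by (intro path_word) (auto simp: init_rule_def)
  ultimately have "path ?E ([], Init) ([Internal 2] @ replicate k (Post 0) @ [Post 0, Post 1]) ([], Entry)"
    by (intro path_append)
  then show ?thesis by simp
qed

text \<open>Among these rules only the flush leads to \<open>Entry\<close>, and it ends in
  \<open>Post 0\<close>. This is why \<open>init_rule\<close> ends in \<open>Post 1\<close>: no
  flush may pass the state that carries the loop.\<close>

lemma rules_not_through_loop: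
  assumes "(q, \<sigma>, v @ [Post 0, Post 1], Entry) \<in> rules p n a"
  shows False
proof -
  from assms obtain "v @ [Post 0, Post 1] = flush n"
    by (cases rule: rules_cases) auto
  then have "last (v @ [Post 0, Post 1]) = last (flush n)" by simp
  then show False by (simp add: flush_def)
qed

text \<open>Internal letters are read only in states with nothing left to emit, so a word whose only internal
  letter is its first one stays within a single rule.\<close>

lemma path_imp_rule:
  assumes "path (base_edges p n \<union> load_edges a) x (Internal \<sigma> # u) y" "\<And>i. Internal i \<notin> set u"
  shows "\<exists>v. fst x = [] \<and> (snd x, \<sigma>, v, snd y) \<in> insert init_rule (rules p n a) \<and>
    (snd x \<noteq> Init \<longrightarrow> v = u @ fst y)"
  using assms
proof (induction u arbitrary: y rule: rev_induct)
  case Nil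
  then have "(x, Internal \<sigma>, y) \<in> base_edges p n \<union> load_edges a"
    using path_snocD[of _ x "[]"] path_NilD by fastforce
  from Internal_edge[OF this] show ?case by (intro exI[of _ "fst y"]) simp
next
  case (snoc l u)
  obtain z where z: "path (base_edges p n \<union> load_edges a) x (Internal \<sigma> # u) z"
    "(z, l, y) \<in> base_edges p n \<union> load_edges a"
    using path_snocD[of _ x "Internal \<sigma> # u" l y] snoc.prems(1) by (metis append_Cons)
  have "Internal i \<notin> set u" for i using snoc.prems(2)[of i] by auto
  from snoc.IH[OF z(1) this] obtain v where v: "fst x = []" "(snd x, \<sigma>, v, snd z) \<in> insert init_rule (rules p n a)"
    "snd x \<noteq> Init \<longrightarrow> v = u @ fst z" by blast
  have "l \<noteq> Internal i" for i using snoc.prems(2)[of i] by auto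
  from other_edge[OF z(2) this] have e: "snd y = snd z" "fst z = l # fst y \<or> z = ([Post 0, Post 1], Entry)"
    by auto
  \<comment> \<open>Only from \<open>Init\<close> can a path take the loop, which reads letters
    without removing them from the pending word.\<close>
  have "v = (u @ [l]) @ fst y" if "snd x \<noteq> Init"
  proof -
    have "(snd x, \<sigma>, u @ fst z, snd z) \<in> rules p n a"
      using v that by (auto simp: init_rule_def)
    then have "z \<noteq> ([Post 0, Post 1], Entry)" using rules_not_through_loop by auto
    with e v(3) that show ?thesis by auto
  qed
  with v e(1) show ?case by (intro exI[of _ v]) simp
qed

subsection \<open>The grammars\<close>

text \<open>Only the states of the loading chain are given numbers by a formula: they are the only ones that
  vary with the input, so only their numbers have to be computed.\<close>

definition enc :: "word \<times> node \<Rightarrow> nat" where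
  "enc x = (case snd x of
     Load i \<Rightarrow> if fst x = [] then 3 * i else if fst x = [Post 3] then 3 * i + 1 else 3 * to_nat x + 2
   | _ \<Rightarrow> 3 * to_nat x + 2)"

lemma enc_Load: "enc ([], Load i) = i + i + i" "enc ([Post 3], Load i) = Suc (i + i + i)"
  by (simp_all add: enc_def)

lemma enc_cases:
  "(\<exists>i. x = ([], Load i) \<and> enc x = 3 * i) \<or> (\<exists>i. x = ([Post 3], Load i) \<and> enc x = 3 * i + 1) \<or>
   enc x = 3 * to_nat x + 2"
proof (cases "(\<exists>i. x = ([], Load i)) \<or> (\<exists>i. x = ([Post 3], Load i))")
  case True
  then show ?thesis by (auto simp: enc_Load)
next
  case False
  then have "enc x = 3 * to_nat x + 2"
    unfolding enc_def by (cases x) (auto split: node.split)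
  then show ?thesis by blast
qed

text \<open>The three forms of \<open>enc\<close> have different residues modulo 3.\<close>

lemma enc_inject: "enc x = enc y \<longleftrightarrow> x = y"
proof
  assume eq: "enc x = enc y"
  have mod: "3 * i \<noteq> 3 * j + 1" "3 * i \<noteq> 3 * j + 2" "3 * i + 1 \<noteq> 3 * j + 2" for i j :: nat
    by presburger+
  have "to_nat x = to_nat y \<Longrightarrow> x = y" by simp
  then show "x = y"
    using enc_cases[of x] enc_cases[of y] eq mod by (elim disjE exE conjE) (auto, metis+)
qed simp

fun edge_production :: "edge \<Rightarrow> (nat, (nat, nat) letter) production" where
  "edge_production (x, l, y) = (enc x, [Inr l, Inl (enc y)])"

text \<open>Every sentential form consists of terminals followed by one nonterminal, which no
  production erases.\<close>

lemma derives_edges_iff: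
  "derives (edge_production ` E) [Inl (enc x)] z \<longleftrightarrow> (\<exists>w y. z = map Inr w @ [Inl (enc y)] \<and> path E x w y)"
proof
  assume "derives (edge_production ` E) [Inl (enc x)] z"
  then show "\<exists>w y. z = map Inr w @ [Inl (enc y)] \<and> path E x w y"
    unfolding derives_def
  proof (induction rule: rtranclp_induct)
    case base
    show ?case using path_Nil by (intro exI[of _ "[]"] exI[of _ x]) simp
  next
    case (step z z')
    then obtain w y where w: "z = map Inr w @ [Inl (enc y)]" "path E x w y" by blast
    from step.hyps(2) show ?case
    proof cases
      case (1 A \<alpha> u v)
      from 1(1) w(1) have *: "u @ [Inl A] @ v = map Inr w @ [Inl (enc y)]" by simp
      have "v = []"
      proof (rule ccontr)
        assume "v \<noteq> []"
        then obtain v0 s where v: "v = v0 @ [s]" by (metis rev_exhaust)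
        with * have "u @ [Inl A] @ v0 = map Inr w" by (simp flip: append_assoc)
        then have "Inl A \<in> set (map Inr w)" by (metis in_set_conv_decomp append_Cons append_Nil)
        then show False by auto
      qed
      with * have u: "u = map Inr w" "A = enc y" by auto
      from 1(3) obtain x1 l y1 where e: "(x1, l, y1) \<in> E" "A = enc x1" "\<alpha> = [Inr l, Inl (enc y1)]"
        by auto
      then have "x1 = y" using u(2) enc_inject by simp
      with path_snoc[OF w(2)] e have "path E x (w @ [l]) y1" by blast
      moreover have "z' = map Inr (w @ [l]) @ [Inl (enc y1)]" using 1(2) u(1) \<open>v = []\<close> e(3) by simp
      ultimately show ?thesis by blast
    qed
  qed
next
  assume "\<exists>w y. z = map Inr w @ [Inl (enc y)] \<and> path E x w y"
  then obtain w y where "path E x w y" "z = map Inr w @ [Inl (enc y)]" by blast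
  then show "derives (edge_production ` E) [Inl (enc x)] z"
  proof (induction arbitrary: z rule: path.induct)
    case (path_Nil x)
    then show ?case by (simp add: derives_def)
  next
    case (path_snoc x w y l z')
    have "(enc y, [Inr l, Inl (enc z')]) \<in> edge_production ` E" using path_snoc.hyps(2) by force
    from derive1.intros[OF this, of "map Inr w" "[]"]
    have "derive1 (edge_production ` E) (map Inr w @ [Inl (enc y)]) z" using path_snoc.prems by simp
    with path_snoc.IH[OF refl] show ?case by (simp add: derives_def rtranclp.rtrancl_into_rtrancl)
  qed
qed

text \<open>The handler \<open>\<sigma>\<close> announces itself by \<open>Internal \<sigma>\<close>; everything else is left to the regular grammar.\<close>

definition handler_prods :: "nat \<Rightarrow> (nat, (nat, nat) letter) production list" where
  "handler_prods \<sigma> = [(Suc \<sigma>, [Inl (Suc \<sigma>), Inl 0]), (Suc \<sigma>, [Inr (Internal \<sigma>)]),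
     (0, [Inr (Post \<sigma>)]), (0, [Inr (Cancel \<sigma>)])]"

definition effects :: "nat \<Rightarrow> (nat, nat) letter set" where
  "effects h = Post ` {..<h} \<union> Cancel ` {..<h}"

text \<open>The production of \<open>Suc \<sigma>\<close> is left recursive, so this nonterminal
  stays in front until it becomes \<open>Internal \<sigma>\<close>; behind it there are only 0 and
  effects.\<close>

lemma derives_handler_iff:
  assumes "\<sigma> < h"
  shows "derives (\<Union>\<tau><h. set (handler_prods \<tau>)) [Inl (Suc \<sigma>)] (map Inr w) \<longleftrightarrow>
    (\<exists>u. w = Internal \<sigma> # u \<and> u \<in> lists (effects h))"
    (is "derives ?P _ _ \<longleftrightarrow> _")
proof
  assume "\<exists>u. w = Internal \<sigma> # u \<and> u \<in> lists (effects h)"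
  then obtain u where w: "w = Internal \<sigma> # u" and u: "u \<in> lists (effects h)" by blast
  from u have "derives ?P [Inl (Suc \<sigma>)] (Inl (Suc \<sigma>) # map Inr u)"
  proof (induction u)
    case Nil
    then show ?case by (simp add: derives_def)
  next
    case (Cons l u)
    have "(Suc \<sigma>, [Inl (Suc \<sigma>), Inl 0]) \<in> ?P" using assms by (auto simp: handler_prods_def)
    from derive1.intros[OF this, of "[]" "map Inr u"]
    have "derive1 ?P (Inl (Suc \<sigma>) # map Inr u) (Inl (Suc \<sigma>) # Inl 0 # map Inr u)" by simp
    moreover have "(0, [Inr l]) \<in> ?P" using Cons.hyps by (auto simp: handler_prods_def effects_def)
    from derive1.intros[OF this, of "[Inl (Suc \<sigma>)]" "map Inr u"]
    have "derive1 ?P (Inl (Suc \<sigma>) # Inl 0 # map Inr u) (Inl (Suc \<sigma>) # Inr l # map Inr u)" by simp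
    ultimately show ?case using Cons.IH by (simp add: derives_def rtranclp.rtrancl_into_rtrancl)
  qed
  moreover have "(Suc \<sigma>, [Inr (Internal \<sigma>)]) \<in> ?P" using assms by (auto simp: handler_prods_def)
  from derive1.intros[OF this, of "[]" "map Inr u"]
  have "derive1 ?P (Inl (Suc \<sigma>) # map Inr u) (map Inr w)" by (simp add: w)
  ultimately show "derives ?P [Inl (Suc \<sigma>)] (map Inr w)"
    by (simp add: derives_def rtranclp.rtrancl_into_rtrancl)
next
  let ?S = "insert (Inl 0) (Inr ` effects h)"
  assume "derives ?P [Inl (Suc \<sigma>)] (map Inr w)"
  then have "\<exists>s v. map Inr w = s # v \<and> s \<in> {Inl (Suc \<sigma>), Inr (Internal \<sigma>)} \<and> set v \<subseteq> ?S"
    unfolding derives_def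
  proof (induction rule: rtranclp_induct)
    case base
    then show ?case by simp
  next
    case (step z z')
    then obtain s v where z: "z = s # v" "s \<in> {Inl (Suc \<sigma>), Inr (Internal \<sigma>)}" "set v \<subseteq> ?S" by blast
    from step.hyps(2) show ?case
    proof cases
      case (1 A \<alpha> x y)
      show ?thesis
      proof (cases x)
        case Nil
        with 1 z have A: "A = Suc \<sigma>" "y = v" by auto
        with 1(3) have "\<alpha> = [Inl (Suc \<sigma>), Inl 0] \<or> \<alpha> = [Inr (Internal \<sigma>)]"
          by (auto simp: handler_prods_def)
        with 1(2) Nil A z(3) show ?thesis by auto
      next
        case (Cons s' x')
        with 1 z have x: "s' = s" "v = x' @ [Inl A] @ y" by auto
        with z(3) have "A = 0" by auto
        with 1(3) have "set \<alpha> \<subseteq> ?S" by (auto simp: handler_prods_def effects_def)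
        with 1(2) Cons x z show ?thesis by auto
      qed
    qed
  qed
  then show "\<exists>u. w = Internal \<sigma> # u \<and> u \<in> lists (effects h)"
    by (cases w) (auto simp: in_lists_conv_set)
qed

subsection \<open>Transitions\<close>

lemma count_exec_uncancelled:
  "Cancel b \<notin> set w \<Longrightarrow> count (exec w m) b = count m b + parikh w (Post b)"
  by (induction w m rule: exec.induct) (auto simp: parikh_def)

lemma count_exec_cancelled:
  assumes "Cancel b \<notin> set w2"
  shows "count (exec (w1 @ [Cancel b] @ w2) m) b = parikh w2 (Post b)"
  using count_exec_uncancelled[OF assms] by (simp add: exec_append)

lemma set_exec: "set_mset (exec w m) \<subseteq> set_mset m \<union> {b. Post b \<in> set w}"
  by (induction w m rule: exec.induct) auto

text \<open>For a fixed handler only the letters after its last cancellation count if there is one.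
  A transition says this for each handler separately, while \<open>exec\<close> works through the
  word for all of them at once.\<close>

lemma exec_iff:
  assumes "w \<in> lists A" "\<And>b. Post b \<in> A \<Longrightarrow> b \<in> H" "set_mset m \<subseteq> H" "set_mset m' \<subseteq> H"
  shows "(\<forall>b \<in> H.
          (\<exists>w1 w2. w = w1 @ [Cancel b] @ w2 \<and> w2 \<in> lists (A - {Cancel b}) \<and>
             count m' b = parikh w2 (Post b)) \<or>
          (w \<in> lists (A - {Cancel b}) \<and>
             count m' b = count m b + parikh w (Post b))) \<longleftrightarrow> m' = exec w m"
    (is "(\<forall>b\<in>H. ?C b) \<longleftrightarrow> _")
proof
  assume C: "\<forall>b\<in>H. ?C b"
  show "m' = exec w m"
  proof (rule multiset_eqI)
    fix b
    show "count m' b = count (exec w m) b"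
    proof (cases "b \<in> H")
      case True
      with C have "?C b" by blast
      then show ?thesis
      proof
        assume "\<exists>w1 w2. w = w1 @ [Cancel b] @ w2 \<and> w2 \<in> lists (A - {Cancel b}) \<and>
          count m' b = parikh w2 (Post b)"
        then obtain w1 w2 where w: "w = w1 @ [Cancel b] @ w2" "Cancel b \<notin> set w2"
          "count m' b = parikh w2 (Post b)" by (auto simp: in_lists_conv_set)
        then show ?thesis using count_exec_cancelled by metis
      next
        assume "w \<in> lists (A - {Cancel b}) \<and> count m' b = count m b + parikh w (Post b)"
        then have "Cancel b \<notin> set w" "count m' b = count m b + parikh w (Post b)"
          by (auto simp: in_lists_conv_set)
        then show ?thesis using count_exec_uncancelled by metis
      qed
    next
      case False
      have "set_mset (exec w m) \<subseteq> H" using set_exec[of w m] assms by (auto simp: in_lists_conv_set)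
      with False assms(4) show ?thesis by (metis count_eq_zero_iff subsetD)
    qed
  qed
next
  assume m': "m' = exec w m"
  show "\<forall>b\<in>H. ?C b"
  proof
    fix b
    show "?C b"
    proof (cases "Cancel b \<in> set w")
      case True
      then obtain w1 w2 where w: "w = w1 @ Cancel b # w2" "Cancel b \<notin> set w2"
        by (metis split_list_last)
      then have "w2 \<in> lists (A - {Cancel b})" using assms(1) by (auto simp: in_lists_conv_set)
      moreover have "count m' b = parikh w2 (Post b)"
        using count_exec_cancelled[OF w(2), of w1 m] by (simp add: m' w(1))
      ultimately show ?thesis using w(1) by auto
    next
      case False
      then have "w \<in> lists (A - {Cancel b})" using assms(1) by (auto simp: in_lists_conv_set)
      with False show ?thesis using count_exec_uncancelled m' by blast
    qed
  qed
qed

text \<open>Chain states have numbers up to \<open>3 * Suc a\<close>, while all other states and the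
  letters of the base edges are bounded by \<open>a\<close>; the 10 makes room for this and for the
  small constants. Nonterminal 0 produces the effects and \<open>Suc \<sigma>\<close> belongs to the
  handler \<open>\<sigma>\<close>, hence \<open>a + 11\<close>. Initial segments have easily
  computed codes, and \<open>a + a + a\<close> spares multiplication.\<close>

definition program :: "nat \<Rightarrow> (nat, (nat, nat) letter) production set \<Rightarrow> (nat, nat, nat, nat) acp" where
  "program a R = \<lparr>states = {..<a + a + a + 10}, handlers = {..<a + 10}, internals = {..<a + 10},
     nonterminals = {..<a + 11}, cfg_prods = (\<Union>\<sigma><a + 10. set (handler_prods \<sigma>)),
     handler_nt = restrict Suc {..<a + 10}, reg_prods = R,
     init_state = enc ([], Init), init_pending = {#2#}\<rparr>"

lemma program_simps:
  "states (program a R) = {..<a + a + a + 10}" "handlers (program a R) = {..<a + 10}"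
  "internals (program a R) = {..<a + 10}" "nonterminals (program a R) = {..<a + 11}"
  "cfg_prods (program a R) = (\<Union>\<sigma><a + 10. set (handler_prods \<sigma>))"
  "handler_nt (program a R) = restrict Suc {..<a + 10}" "reg_prods (program a R) = R"
  "init_state (program a R) = enc ([], Init)" "init_pending (program a R) = {#2#}"
  by (simp_all add: program_def)

lemma alphabet_program: "alphabet (program a R) = Internal ` {..<a + 10} \<union> effects (a + 10)"
  by (auto simp: alphabet_def program_simps effects_def)

lemma transition_program_iff:
  "transition (program a R) (d, M) \<sigma> (d', m') \<longleftrightarrow>
    d < a + a + a + 10 \<and> d' < a + a + a + 10 \<and> set_mset M \<subseteq> {..<a + 10} \<and> set_mset m' \<subseteq> {..<a + 10} \<and>
    \<sigma> < a + 10 \<and> (\<exists>m u. M = add_mset \<sigma> m \<and> u \<in> lists (effects (a + 10)) \<and>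
      derives R [Inl d] (map Inr (Internal \<sigma> # u) @ [Inl d']) \<and> m' = exec u m)"
    (is "?L \<longleftrightarrow> ?R")
proof -
  let ?P = "program a R" and ?H = "{..<a + 10}"
  have Post: "b \<in> ?H" if "Post b \<in> alphabet ?P" for b
    using that by (auto simp: alphabet_program effects_def)
  note sel = program_simps[of a R]
  show ?thesis
  proof
    assume L: ?L
    then obtain d1 m d2 m2 w where eq: "(d, M) = (d1, m + {#\<sigma>#})" "(d', m') = (d2, m2)"
      and w: "w \<in> lists (alphabet ?P)"
      "derives (reg_prods ?P) [Inl d1] (map Inr w @ [Inl d2])"
      "derives (cfg_prods ?P) [Inl (handler_nt ?P \<sigma>)] (map Inr w)"
      "\<forall>b \<in> handlers ?P.
          (\<exists>w1 w2. w = w1 @ [Cancel b] @ w2 \<and> w2 \<in> lists (alphabet ?P - {Cancel b}) \<and>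
             count m2 b = parikh w2 (Post b)) \<or>
          (w \<in> lists (alphabet ?P - {Cancel b}) \<and>
             count m2 b = count m b + parikh w (Post b))"
      unfolding transition_def by blast
    have b: "d < a + a + a + 10" "d' < a + a + a + 10" "set_mset M \<subseteq> ?H" "set_mset m' \<subseteq> ?H" "\<sigma> < a + 10"
      using L by (auto simp: transition_def configs_def sel)
    have m: "M = add_mset \<sigma> m" "w \<in> lists (alphabet ?P)" "derives R [Inl d] (map Inr w @ [Inl d'])"
      "derives (cfg_prods ?P) [Inl (handler_nt ?P \<sigma>)] (map Inr w)"
      using eq w by (simp_all add: sel)
    have "m2 = m'" using eq(2) by simp
    note c = w(4)[unfolded sel this]
    have "m' = exec w m"
      using c exec_iff[OF m(2) Post, of m m'] b m(1) by auto
    moreover have "handler_nt ?P \<sigma> = Suc \<sigma>" using b(5) by (simp add: sel)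
    with m(4) derives_handler_iff[OF b(5), of w] obtain u where
      "w = Internal \<sigma> # u" "u \<in> lists (effects (a + 10))" by (auto simp: sel)
    ultimately show ?R using m b by auto
  next
    assume ?R
    then obtain m u where m: "M = add_mset \<sigma> m" and u: "u \<in> lists (effects (a + 10))"
      and d: "derives R [Inl d] (map Inr (Internal \<sigma> # u) @ [Inl d'])" and m': "m' = exec u m"
      and b: "d < a + a + a + 10" "d' < a + a + a + 10" "set_mset M \<subseteq> ?H" "set_mset m' \<subseteq> ?H" "\<sigma> < a + 10"
      by blast
    let ?w = "Internal \<sigma> # u"
    have w: "?w \<in> lists (alphabet ?P)" using u b(5) by (auto simp: alphabet_program in_lists_conv_set)
    have "\<forall>b \<in> ?H.
          (\<exists>w1 w2. ?w = w1 @ [Cancel b] @ w2 \<and> w2 \<in> lists (alphabet ?P - {Cancel b}) \<and>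
             count m' b = parikh w2 (Post b)) \<or>
          (?w \<in> lists (alphabet ?P - {Cancel b}) \<and>
             count m' b = count m b + parikh ?w (Post b))"
      using exec_iff[OF w Post, of m m'] b m m' by auto
    moreover have "derives (cfg_prods ?P) [Inl (handler_nt ?P \<sigma>)] (map Inr ?w)"
      using derives_handler_iff[OF b(5), of ?w] u b(5) by (simp add: sel del: list.map)
    ultimately show ?L
      unfolding transition_def configs_def using m w d b
      by (intro conjI exI[of _ d] exI[of _ m] exI[of _ d'] exI[of _ m'] exI[of _ ?w]) (simp_all add: sel del: list.map)
  qed
qed

subsection \<open>Infinite runs\<close>

fun letter_index :: "(nat, nat) letter \<Rightarrow> nat" where
  "letter_index (Internal i) = i"
| "letter_index (Post i) = i"
| "letter_index (Cancel i) = i"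

definition fits :: "nat \<Rightarrow> edge set \<Rightarrow> bool" where
  "fits a E \<longleftrightarrow> (\<forall>(x, l, y) \<in> E. enc x < a + a + a + 10 \<and> enc y < a + a + a + 10 \<and> letter_index l < a + 10)"

lemma load_edges_eq:
  "load_edges a = {(([], Entry), Internal 0, ([Post 3], Load a)), (([Post 3], Load a), Post 3, ([], Load a))} \<union>
    (\<Union>i<Suc a. {(([], Load (Suc i)), Internal 0, ([Post 3], Load i)), (([Post 3], Load i), Post 3, ([], Load i))})"
proof -
  have "{(Load (Suc i), 0, [Post 3], Load i) | i. i \<le> a} = ((\<lambda>i. (Load (Suc i), 0, [Post 3], Load i)) ` {..<Suc a} :: rule set)"
    by auto
  then show ?thesis
    by (simp only: load_edges_def load_rules_def UN_insert image_image rule_edges.simps word_edges.simps)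
qed

text \<open>The only state of these edges outside the chain is \<open>Entry\<close>, which also
  occurs in the base edges.\<close>

lemma fits_load_edges:
  assumes "fits a (base_edges p n)"
  shows "fits a (load_edges a)"
proof -
  have "(([], Init), Internal 2, ([Post 0, Post 1], Entry)) \<in> base_edges p n"
    by (simp add: base_edges_def init_rule_def)
  moreover have "(([Post 1], Entry), Post 1, ([], Entry)) \<in> base_edges p n"
    by (simp add: base_edges_def init_rule_def)
  ultimately have "enc ([], Entry) < a + a + a + 10" using assms by (fastforce simp: fits_def)
  then show ?thesis by (auto simp: fits_def load_edges_eq enc_Load)
qed

lemma fitsD:
  assumes "fits a E" "(x, l, y) \<in> E"
  shows "enc x < a + a + a + 10" "enc y < a + a + a + 10" "letter_index l < a + 10"
  using assms by (auto simp: fits_def)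

lemma async_program_program:
  assumes "fits a E" "enc ([], Init) < a + a + a + 10"
  shows "async_program (program a (edge_production ` E))"
proof -
  have al: "l \<in> alphabet (program a R)" if "letter_index l < a + 10" for l R
    using that by (cases l) (auto simp: alphabet_program effects_def)
  have "edge_production ` E \<subseteq> {..<a + a + a + 10} \<times>
      ({[Inr l, Inl d] | l d. l \<in> alphabet (program a (edge_production ` E)) \<and> d \<in> {..<a + a + a + 10}} \<union> {[]})"
    using fitsD[OF assms(1)] al by fastforce
  moreover have "(\<Union>\<sigma><a + 10. set (handler_prods \<sigma>)) \<subseteq> {..<a + 11} \<times>
       ({[Inl Y, Inl Z] | Y Z. Y \<in> {..<a + 11} \<and> Z \<in> {..<a + 11}} \<union>
        {[Inr l] | l. l \<in> alphabet (program a (edge_production ` E))} \<union> {[]})"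
    using al by (auto simp: handler_prods_def)
  ultimately show ?thesis
    using assms(2) unfolding async_program_def program_simps by auto
qed

lemma word_edges_letters: "x \<in> set u \<Longrightarrow> \<exists>y z. (y, x, z) \<in> word_edges u q"
  by (induction u) auto

lemma set_exec_effects:
  assumes "u \<in> lists (effects h)" "set_mset m \<subseteq> {..<h}"
  shows "set_mset (exec u m) \<subseteq> {..<h}"
  using set_exec[of u m] assms by (auto simp: in_lists_conv_set effects_def)

lemma transitionI:
  assumes "path E ([], q) (Internal \<sigma> # u) ([], q')" "u \<in> lists (effects (a + 10))" "\<sigma> < a + 10"
    "set_mset m \<subseteq> {..<a + 10}" "enc ([], q) < a + a + a + 10" "enc ([], q') < a + a + a + 10"
  shows "transition (program a (edge_production ` E)) (enc ([], q), add_mset \<sigma> m) \<sigma> (enc ([], q'), exec u m)"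
proof -
  have "derives (edge_production ` E) [Inl (enc ([], q))] (map Inr (Internal \<sigma> # u) @ [Inl (enc ([], q'))])"
    unfolding derives_edges_iff using assms(1) by blast
  then show ?thesis
    unfolding transition_program_iff using assms(2-) set_exec_effects[OF assms(2,4)] by auto
qed

lemma nstep_imp_transition:
  assumes "nstep p n a (q, m) (q', m')" "fits a (base_edges p n)" "set_mset m \<subseteq> {..<a + 10}"
  shows "\<exists>\<sigma>. transition (program a (edge_production ` (base_edges p n \<union> load_edges a)))
    (enc ([], q), m) \<sigma> (enc ([], q'), m')"
proof -
  let ?E = "base_edges p n \<union> load_edges a"
  obtain \<sigma> u m0 where r: "(q, \<sigma>, u, q') \<in> rules p n a" and m: "m = add_mset \<sigma> m0" "m' = exec u m0"
    using assms(1) by (auto simp: nstep_def)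
  have fit: "fits a ?E" using assms(2) fits_load_edges[OF assms(2)] by (auto simp: fits_def)
  have sub: "rule_edges (q, \<sigma>, u, q') \<subseteq> ?E" using r unfolding edges_eq by blast
  then have "(([], q), Internal \<sigma>, (u, q')) \<in> ?E" by simp
  note b = fitsD[OF fit this]
  have "l \<in> effects (a + 10)" if l: "l \<in> set u" for l
  proof -
    obtain x z where "(x, l, z) \<in> word_edges u q'" using word_edges_letters[OF l] by blast
    with sub have "letter_index l < a + 10" by (intro fitsD(3)[OF fit]) auto
    moreover have "l \<noteq> Internal i" for i using rules_word[of q \<sigma> u q' p n a i] r l by auto
    ultimately show ?thesis by (cases l) (auto simp: effects_def)
  qed
  then have u: "u \<in> lists (effects (a + 10))" by auto
  have "enc ([], q') < a + a + a + 10"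
  proof (cases u rule: rev_cases)
    case Nil
    then show ?thesis using b by simp
  next
    case (snoc v l)
    then have "(([l], q'), l, ([], q')) \<in> word_edges u q'" by (simp add: word_edges_iff)
    with sub show ?thesis by (intro fitsD(2)[OF fit]) auto
  qed
  with transitionI[OF path_rule[OF sub] u] b assms(3) show ?thesis by (auto simp: m)
qed

lemma infinite_run_imp_halts:
  assumes "has_infinite_run (program a (edge_production ` (base_edges p n \<union> load_edges a)))"
    and "register_bound p n"
  shows "halts p (Suc a)"
proof -
  let ?E = "base_edges p n \<union> load_edges a"
  let ?P = "program a (edge_production ` ?E)"
  obtain \<rho> where \<rho>: "\<rho> 0 = (enc ([], Init), {#2#})" "\<And>i. \<exists>\<sigma>. transition ?P (\<rho> i) \<sigma> (\<rho> (Suc i))"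
    using assms(1) by (auto simp: has_infinite_run_def program_simps)
  have step: "\<exists>y \<sigma> u m. fst (\<rho> (Suc i)) = enc y \<and> path ?E x (Internal \<sigma> # u) y \<and> (\<forall>i. Internal i \<notin> set u) \<and>
      snd (\<rho> i) = add_mset \<sigma> m \<and> snd (\<rho> (Suc i)) = exec u m" if x: "fst (\<rho> i) = enc x" for i x
  proof -
    obtain \<sigma> where "transition ?P (enc x, snd (\<rho> i)) \<sigma> (fst (\<rho> (Suc i)), snd (\<rho> (Suc i)))"
      using \<rho>(2)[of i] unfolding x[symmetric] prod.collapse by blast
    then obtain m u w y where u: "snd (\<rho> i) = add_mset \<sigma> m" "u \<in> lists (effects (a + 10))"
      "map Inr (Internal \<sigma> # u) @ [Inl (fst (\<rho> (Suc i)))] = map Inr w @ [Inl (enc y)]"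
      "path ?E x w y" "snd (\<rho> (Suc i)) = exec u m"
      unfolding transition_program_iff derives_edges_iff by blast
    from u(3) have "map Inr (Internal \<sigma> # u) = (map Inr w :: (nat + _) list)" "fst (\<rho> (Suc i)) = enc y"
      by (simp_all only: append1_eq_conv sum.inject)
    moreover from this have "w = Internal \<sigma> # u" by (metis inj_map_eq_map inj_Inr)
    moreover have "\<forall>i. Internal i \<notin> set u" using u(2) by (auto simp: in_lists_conv_set effects_def)
    ultimately show ?thesis using u by blast
  qed
  \<comment> \<open>A transition might stop halfway through a rule. The next one, however, starts
    with an internal letter, which is read only when nothing is left to emit.\<close>
  have "\<exists>q. fst (\<rho> i) = enc ([], q)" for i
  proof (induction i)
    case 0
    then show ?case using \<rho>(1) by auto
  next
    case (Suc i)
    then obtain x where "fst (\<rho> i) = enc x" by blast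
    from step[OF this] obtain y where y: "fst (\<rho> (Suc i)) = enc y" by blast
    from step[OF y] obtain \<sigma> u z where "path ?E y (Internal \<sigma> # u) z" by blast
    from path_ConsD[OF this] Internal_edge have "fst y = []" by blast
    with y show ?case by (metis prod.collapse)
  qed
  then obtain q where q: "\<And>i. fst (\<rho> i) = enc ([], q i)" by metis
  have rule: "\<exists>\<sigma> v. (q i, \<sigma>, v, q (Suc i)) \<in> insert init_rule (rules p n a) \<and>
      (q i \<noteq> Init \<longrightarrow> (\<exists>m. snd (\<rho> i) = add_mset \<sigma> m \<and> snd (\<rho> (Suc i)) = exec v m))" for i
  proof -
    from step[OF q[of i]] obtain y \<sigma> u m where y: "fst (\<rho> (Suc i)) = enc y"
      "path ?E ([], q i) (Internal \<sigma> # u) y" "\<And>i. Internal i \<notin> set u"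
      "snd (\<rho> i) = add_mset \<sigma> m" "snd (\<rho> (Suc i)) = exec u m" by blast
    have "y = ([], q (Suc i))" using y(1) q[of "Suc i"] enc_inject by simp
    with path_imp_rule[OF y(2,3)] y show ?thesis by auto
  qed
  have not_Init: "q (Suc i) \<noteq> Init" for i
    using rule[of i] by (auto simp: init_rule_def elim!: rules_cases)
  \<comment> \<open>The first transition, which guesses the budget, is dropped: the argument about
    the net allows any initial multiset.\<close>
  let ?c = "\<lambda>i. (q (Suc i), snd (\<rho> (Suc i)))"
  have "nstep p n a (?c i) (?c (Suc i))" for i
  proof -
    from rule[of "Suc i"] not_Init[of i] obtain \<sigma> v m where
      "(q (Suc i), \<sigma>, v, q (Suc (Suc i))) \<in> rules p n a"
      "snd (\<rho> (Suc i)) = add_mset \<sigma> m" "snd (\<rho> (Suc (Suc i))) = exec v m"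
      by (auto simp: init_rule_def)
    with nstepI show ?thesis by metis
  qed
  then show ?thesis using infinite_net_run_imp_halts[where c = ?c] assms(2) by blast
qed

lemma halts_imp_infinite_run:
  assumes "halts p (Suc a)" and n: "register_bound p n" and fits: "fits a (base_edges p n)"
    and init: "enc ([], Init) < a + a + a + 10"
  shows "has_infinite_run (program a (edge_production ` (base_edges p n \<union> load_edges a)))"
proof -
  let ?P = "program a (edge_production ` (base_edges p n \<union> load_edges a))"
  let ?R = "nstep p n a"
  obtain N where N: "\<And>m. count m 0 \<ge> N \<Longrightarrow> set_mset m \<subseteq> {0, 1} \<Longrightarrow>
      ?R\<^sup>+\<^sup>+ (Entry, m) (Entry, replicate_mset (size m) 0)"
    using halts_imp_net_cycle[OF assms(1) n] by blast
  \<comment> \<open>What the first transition posts when it takes the loop \<open>N\<close>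
    times.\<close>
  let ?m = "add_mset 1 (replicate_mset (Suc N) 0)"
  let ?c = "(Entry, replicate_mset (Suc (Suc N)) 0)"
  have start: "?R\<^sup>*\<^sup>* (Entry, ?m) ?c" using N[of ?m] by (auto intro: tranclp_into_rtranclp)
  have cycle: "?R\<^sup>+\<^sup>+ ?c ?c" using N[of "snd ?c"] by auto
  \<comment> \<open>Whoever can reach \<open>?c\<close> can make a step and still reach it, because
    \<open>?c\<close> lies on a cycle. Dependent choice turns this into an infinite run.\<close>
  have next_step: "\<exists>d. ?R c d \<and> ?R\<^sup>*\<^sup>* d ?c" if "?R\<^sup>*\<^sup>* c ?c" for c
    using that
  proof (cases rule: converse_rtranclpE)
    case base
    then show ?thesis using tranclpD[OF cycle] by simp
  next
    case (step d)
    then show ?thesis by blast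
  qed
  obtain c where c: "c 0 = (Entry, ?m)" "\<And>i. ?R\<^sup>*\<^sup>* (c i) ?c" "\<And>i. ?R (c i) (c (Suc i))"
    using dependent_nat_choice[of "\<lambda>i c. (i = 0 \<longrightarrow> c = (Entry, ?m)) \<and> ?R\<^sup>*\<^sup>* c ?c" "\<lambda>_. ?R"]
      start next_step by (metis (no_types, lifting) nat.distinct(1))
  have proper: "proper n (snd (c i))" for i
  proof (induction i)
    case 0
    then show ?case by (auto simp: c(1) proper_def)
  next
    case (Suc i)
    then show ?case by (rule nstep_proper[OF c(3) _ n])
  qed
  have "r + 3 < a + 10" if "r < n" for r
  proof -
    have "(Run [], r + 3, [Post 0], Run []) \<in> base_rules p n"
      using that Nil_in_conts[of p] by (force simp: base_rules_def)
    then have "(([], Run []), Internal (r + 3), ([Post 0], Run [])) \<in> base_edges p n"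
      by (force simp: base_edges_def)
    from fitsD(3)[OF fits this] show ?thesis by simp
  qed
  then have handlers: "set_mset (snd (c i)) \<subseteq> {..<a + 10}" for i
    using proper[of i] unfolding proper_def by (fastforce dest: le_Suc_ex simp: atLeastLessThan_iff)
  let ?\<rho> = "\<lambda>i. case i of 0 \<Rightarrow> (enc ([], Init), {#2#}) | Suc j \<Rightarrow> (enc ([], fst (c j)), snd (c j))"
  have "\<exists>\<sigma>. transition ?P (?\<rho> i) \<sigma> (?\<rho> (Suc i))" for i
  proof (cases i)
    case 0
    let ?u = "replicate N (Post 0) @ [Post 0, Post 1] :: word"
    have ex: "exec (replicate N (Post 0)) m = replicate_mset N 0 + m" for m
      by (induction N arbitrary: m) auto
    have "?u \<in> lists (effects (a + 10))" by (auto simp: effects_def)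
    moreover have "enc ([], Entry) < a + a + a + 10"
    proof -
      have "(([Post 1], Entry), Post 1, ([], Entry)) \<in> base_edges p n"
        by (simp add: base_edges_def init_rule_def)
      from fitsD(2)[OF fits this] show ?thesis .
    qed
    ultimately have "transition ?P (enc ([], Init), add_mset 2 {#}) 2 (enc ([], Entry), exec ?u {#})"
      using init by (intro transitionI path_init) auto
    then show ?thesis by (auto simp: 0 c(1) exec_append ex)
  next
    case (Suc j)
    then show ?thesis
      using nstep_imp_transition[of p n a "fst (c j)" "snd (c j)" "fst (c (Suc j))" "snd (c (Suc j))"]
        c(3)[of j] fits handlers by simp
  qed
  then show ?thesis
    unfolding has_infinite_run_def by (intro exI[of _ ?\<rho>]) (simp add: program_simps)
qed

section \<open>Computing the codes\<close>

definition computable :: "nat \<Rightarrow> (nat list \<Rightarrow> nat) \<Rightarrow> bool" where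
  "computable k F \<longleftrightarrow> (\<exists>f. \<forall>xs. length xs = k \<longrightarrow> rec_eval f xs (F xs))"

lemma computable_nth: "i < k \<Longrightarrow> computable k (\<lambda>xs. xs ! i)"
  unfolding computable_def by (intro exI[of _ "Proj i"]) (auto intro: rec_eval.intros)

lemma computable_Suc:
  assumes "computable k F"
  shows "computable k (\<lambda>xs. Suc (F xs))"
proof -
  obtain f where f: "\<And>xs. length xs = k \<Longrightarrow> rec_eval f xs (F xs)"
    using assms by (auto simp: computable_def)
  have "rec_eval (Comp Succ [f]) xs (Suc (F xs))" if "length xs = k" for xs
    using f[OF that] by (intro rec_eval.intros(4)[where ys = "[F xs]"]) (auto intro: rec_eval.intros)
  then show ?thesis unfolding computable_def by blast
qed

lemma computable_const: "computable k (\<lambda>_. c)"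
proof (induction c)
  case 0
  then show ?case unfolding computable_def by (intro exI[of _ Zero]) (auto intro: rec_eval.intros)
qed (rule computable_Suc)

text \<open>\<open>G\<close> sees only the index and the previous value; parameters enter through
  the start value and the number of rounds, as in all the codes below.\<close>

lemma computable_rec_nat:
  assumes "computable 2 (\<lambda>ys. G (ys ! 0) (ys ! 1))" "computable k A" "computable k N"
  shows "computable k (\<lambda>xs. rec_nat (A xs) G (N xs))"
proof -
  obtain g where g: "\<And>xs. length xs = 2 \<Longrightarrow> rec_eval g xs (G (xs ! 0) (xs ! 1))"
    using assms(1) by (auto simp: computable_def)
  obtain f where f: "\<And>xs. length xs = k \<Longrightarrow> rec_eval f xs (A xs)"
    using assms(2) by (auto simp: computable_def)
  obtain h where h: "\<And>xs. length xs = k \<Longrightarrow> rec_eval h xs (N xs)"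
    using assms(3) by (auto simp: computable_def)
  let ?g = "Comp g [Proj 0, Proj 1]"
  have rec: "rec_eval (PrimRec (Proj 0) ?g) [i, b] (rec_nat b G i)" for i b
  proof (induction i)
    case 0
    have "rec_eval (Proj 0) [b] ([b] ! 0)" by (rule rec_eval.intros) simp
    then show ?case by (auto intro: rec_eval.intros)
  next
    case (Suc i)
    let ?ys = "[i, rec_nat b G i, b]"
    have "rec_eval (Proj 0) ?ys (?ys ! 0)" "rec_eval (Proj 1) ?ys (?ys ! 1)"
      by (rule rec_eval.intros; simp)+
    moreover have "rec_eval g [i, rec_nat b G i] (G i (rec_nat b G i))"
      using g[of "[i, rec_nat b G i]"] by simp
    ultimately have "rec_eval ?g ?ys (G i (rec_nat b G i))"
      by (intro rec_eval.intros(4)[where ys = "[i, rec_nat b G i]"]) auto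
    with Suc show ?case by (auto intro: rec_eval.intros)
  qed
  have "rec_eval (Comp (PrimRec (Proj 0) ?g) [h, f]) xs (rec_nat (A xs) G (N xs))" if "length xs = k" for xs
    using f[OF that] h[OF that] rec by (intro rec_eval.intros(4)[where ys = "[N xs, A xs]"]) auto
  then show ?thesis unfolding computable_def by blast
qed

lemma computable_pred:
  assumes "computable k F"
  shows "computable k (\<lambda>xs. F xs - 1)"
proof -
  have "computable k (\<lambda>xs. rec_nat 0 (\<lambda>i _. i) (F xs))"
    by (intro computable_rec_nat computable_nth computable_const assms) simp
  moreover have "rec_nat 0 (\<lambda>i _. i) m = m - 1" for m :: nat by (cases m) auto
  ultimately show ?thesis by simp
qed

lemma computable_add:
  assumes "computable k F" "computable k G"
  shows "computable k (\<lambda>xs. F xs + G xs)"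
proof -
  have "computable k (\<lambda>xs. rec_nat (F xs) (\<lambda>_ r. Suc r) (G xs))"
    by (intro computable_rec_nat computable_Suc computable_nth assms) simp
  moreover have "rec_nat b (\<lambda>_ r. Suc r) m = b + m" for b m :: nat by (induction m) auto
  ultimately show ?thesis by simp
qed

lemma computable_prod_encode:
  assumes "computable k F" "computable k G"
  shows "computable k (\<lambda>xs. prod_encode (F xs, G xs))"
proof -
  have "computable k (\<lambda>xs. rec_nat 0 (\<lambda>i r. r + Suc i) (F xs + G xs) + F xs)"
    by (intro computable_add computable_rec_nat computable_Suc computable_nth computable_const assms) simp_all
  moreover have "rec_nat 0 (\<lambda>i r. r + Suc i) m = triangle m" for m by (induction m) auto
  ultimately show ?thesis by (simp add: prod_encode_def)
qed

lemmas computable_intros = computable_prod_encode computable_add computable_Suc computable_nth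
  computable_rec_nat computable_pred computable_const

text \<open>Counting down puts each new block in front, where the code of a list can be extended
  arithmetically.\<close>

fun down :: "(nat \<Rightarrow> 'b list) \<Rightarrow> nat \<Rightarrow> 'b list" where
  "down e 0 = []"
| "down e (Suc n) = e n @ down e n"

lemma set_down: "set (down e n) = (\<Union>i<n. set (e i))"
  by (induction n) (auto simp: less_Suc_eq)

lemma map_down: "map f (down e n) = down (\<lambda>i. map f (e i)) n"
  by (induction n) auto

lemma down_cong: "(\<And>i. i < n \<Longrightarrow> e i = e' i) \<Longrightarrow> down e n = down e' n"
  by (induction n) auto

text \<open>For an explicit block \<open>e i\<close>, unfolding \<open>list_encode\<close> leaves
  \<open>list_encode (list_decode r)\<close>, which is \<open>r\<close>. So no decoding has to be
  computed.\<close>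

lemma list_encode_down_append:
  "list_encode (down e n @ ys) = rec_nat (list_encode ys) (\<lambda>i r. list_encode (e i @ list_decode r)) n"
proof (induction n)
  case (Suc n)
  then show ?case by (simp flip: Suc.IH)
qed simp

lemma list_encode_down:
  "list_encode (down e n) = rec_nat 0 (\<lambda>i r. list_encode (e i @ list_decode r)) n"
  using list_encode_down_append[of e n "[]"] by simp

definition load_prods :: "nat \<Rightarrow> (nat, (nat, nat) letter) production list" where
  "load_prods i = [edge_production (([], Load (Suc i)), Internal 0, ([Post 3], Load i)),
     edge_production (([Post 3], Load i), Post 3, ([], Load i))]"

definition entry_prods :: "nat \<Rightarrow> (nat, (nat, nat) letter) production list" where
  "entry_prods a = [edge_production (([], Entry), Internal 0, ([Post 3], Load a)),
     edge_production (([Post 3], Load a), Post 3, ([], Load a))]"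

text \<open>The argument \<open>a\<close> is the code of the list of productions that do not depend on \<open>a\<close>.\<close>

definition self_code :: "nat \<Rightarrow> nat" where
  "self_code a = list_encode
     [list_encode (down (\<lambda>i. [i]) (a + a + a + 10)),
      list_encode (down (\<lambda>\<sigma>. [prod_encode (\<sigma>, Suc \<sigma>)]) (a + 10)),
      list_encode (down (\<lambda>i. [i]) (a + 10)),
      list_encode (down (\<lambda>i. [i]) (a + 11)),
      list_encode (down (\<lambda>\<sigma>. map production_encode (handler_prods \<sigma>)) (a + 10)),
      list_encode (map production_encode (entry_prods a) @
        down (\<lambda>i. map production_encode (load_prods i)) (Suc a) @ list_decode a),
      enc ([], Init),
      list_encode [2]]"

lemma symbol_encode_simps:
  "symbol_encode (Inl d) = d + d" "symbol_encode (Inr l) = Suc (letter_encode l + letter_encode l)"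
  by (simp_all add: symbol_encode_def sum_encode_def)

text \<open>The predecessor undoes the extra token of the entry: the machine is started on
  \<open>Suc a\<close>.\<close>

lemma computable_self_code: "computable 1 (\<lambda>xs. self_code (xs ! 0 - 1))"
  unfolding self_code_def list_encode_down list_encode_down_append list_encode.simps
    list.map append.simps handler_prods_def load_prods_def entry_prods_def edge_production.simps
    production_encode_def prod.case symbol_encode_simps letter_encode.simps enc_Load
    list_decode_inverse
  by (intro computable_intros) simp_all

text \<open>A code may list the productions in any order. With the constant ones last, the code of
  the list arises from \<open>a\<close> by prepending.\<close>

lemma program_code_self_code:
  assumes "a = list_encode (map production_encode bs)" "set bs = edge_production ` base_edges p n"
  shows "program_code (program a (edge_production ` (base_edges p n \<union> load_edges a))) (self_code a)"
proof -
  let ?rs = "entry_prods a @ down load_prods (Suc a) @ bs"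
  let ?P = "program a (edge_production ` (base_edges p n \<union> load_edges a))"
  have hs: "map (\<lambda>\<sigma>. prod_encode (\<sigma>, restrict Suc {..<a + 10} \<sigma>)) (down (\<lambda>i. [i]) (a + 10))
      = down (\<lambda>\<sigma>. [prod_encode (\<sigma>, Suc \<sigma>)]) (a + 10)"
    unfolding map_down by (rule down_cong) simp
  have rs: "map production_encode ?rs = map production_encode (entry_prods a) @
        down (\<lambda>i. map production_encode (load_prods i)) (Suc a) @ list_decode a"
    unfolding map_append map_down assms(1) list_encode_inverse ..
  show ?thesis
    unfolding program_code_def program_simps
  proof (intro exI conjI)
    show "set (down (\<lambda>i. [i]) (a + a + a + 10)) = {..<a + a + a + 10}"
      "set (down (\<lambda>i. [i]) (a + 10)) = {..<a + 10}" "set (down (\<lambda>i. [i]) (a + 10)) = {..<a + 10}"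
      "set (down (\<lambda>i. [i]) (a + 11)) = {..<a + 11}"
      "set (down handler_prods (a + 10)) = (\<Union>\<sigma><a + 10. set (handler_prods \<sigma>))"
      by (auto simp only: set_down list.set)
    show "set ?rs = edge_production ` (base_edges p n \<union> load_edges a)"
      unfolding set_append set_down assms(2) load_edges_eq entry_prods_def load_prods_def
      by (auto simp: image_Un image_UN)
    show "mset [2] = {#2#}" by simp
  qed (simp only: self_code_def hs rs map_down[of production_encode handler_prods])
qed

section \<open>Codes bound the numbers in them\<close>

lemma le_list_encode: "x \<in> set xs \<Longrightarrow> x \<le> list_encode xs"
proof (induction xs)
  case (Cons y xs)
  have "y \<le> prod_encode (y, list_encode xs)" "list_encode xs \<le> prod_encode (y, list_encode xs)"
    by (rule le_prod_encode_1, rule le_prod_encode_2)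
  with Cons show ?case by auto
qed simp

lemma le_symbol_encode: "d \<le> symbol_encode (Inl d)" "letter_index l \<le> symbol_encode (Inr l)"
proof -
  have "letter_index l \<le> letter_encode l" by (cases l) (auto intro: le_prod_encode_2)
  then show "letter_index l \<le> symbol_encode (Inr l)" by (simp add: symbol_encode_simps)
qed (simp add: symbol_encode_simps)

lemma le_production_encode:
  "A \<le> production_encode (A, \<alpha>)" "s \<in> set \<alpha> \<Longrightarrow> symbol_encode s \<le> production_encode (A, \<alpha>)"
  using order_trans[OF le_list_encode le_prod_encode_2, of "symbol_encode s" "map symbol_encode \<alpha>" A]
  by (auto simp: production_encode_def intro: le_prod_encode_1)

lemma edges_le_code:
  assumes "a = list_encode (map production_encode bs)" "set bs = edge_production ` E" "(x, l, y) \<in> E"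
  shows "enc x \<le> a \<and> enc y \<le> a \<and> letter_index l \<le> a"
proof -
  let ?\<pi> = "(enc x, [Inr l, Inl (enc y)])"
  have "?\<pi> \<in> set bs" using assms(2,3) by force
  then have c: "production_encode ?\<pi> \<le> a" unfolding assms(1) by (intro le_list_encode) simp
  have "enc x \<le> production_encode ?\<pi>" by (rule le_production_encode)
  moreover have "symbol_encode (Inr l) \<le> production_encode ?\<pi>" "symbol_encode (Inl (enc y)) \<le> production_encode ?\<pi>"
    by (rule le_production_encode; simp)+
  ultimately show ?thesis using c le_symbol_encode(1)[of "enc y"] le_symbol_encode(2)[of l] by linarith
qed

section \<open>The diagonal argument\<close>

theorem theorem7p8:
  "\<not> decidable program_code {P. async_program P} has_infinite_run"
proof
  assume "decidable program_code {P. async_program P} has_infinite_run"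
  then obtain f where f: "\<And>P c. async_program P \<Longrightarrow> program_code P c \<Longrightarrow>
      rec_eval f [c] (if has_infinite_run P then 1 else 0)"
    unfolding decidable_def by auto
  obtain g where g: "\<And>x. rec_eval g [x] (self_code (x - 1))"
    using computable_self_code unfolding computable_def by (metis One_nat_def length_Cons list.size(3) nth_Cons_0)
  have fg: "rec_eval (Comp f [g]) [Suc a] y" if "rec_eval f [self_code a] y" for a y
    using g[of "Suc a"] that by (intro rec_eval.intros(4)[where ys = "[self_code a]"]) auto
  obtain p where p: "\<And>x y. rec_eval (Comp f [g]) [x] y \<Longrightarrow> halts p x \<longleftrightarrow> y = 0"
    using program_halts_iff_zero[of "Comp f [g]"] by auto
  obtain n where n: "register_bound p n" by (rule register_bound_exists)
  obtain bs where bs: "set bs = edge_production ` base_edges p n"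
    using finite_list[of "edge_production ` base_edges p n"] finite_base_edges by auto
  define a where "a = list_encode (map production_encode bs)"
  let ?P = "program a (edge_production ` (base_edges p n \<union> load_edges a))"
  have le: "enc x \<le> a \<and> enc y \<le> a \<and> letter_index l \<le> a" if "(x, l, y) \<in> base_edges p n" for x l y
    using edges_le_code[OF a_def bs that] .
  have fits: "fits a (base_edges p n)" unfolding fits_def by (auto dest!: le)
  have "(([], Init), Internal 2, ([Post 0, Post 1], Entry)) \<in> base_edges p n"
    by (simp add: base_edges_def init_rule_def)
  from le[OF this] have init: "enc ([], Init) < a + a + a + 10" by simp
  have "fits a (base_edges p n \<union> load_edges a)"
    using fits fits_load_edges[OF fits] by (auto simp: fits_def)
  then have "async_program ?P" using init by (rule async_program_program)
  \<comment> \<open>The procedure is known to be defined only on codes of programs;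
    \<open>self_code a\<close> is one, namely a code of \<open>?P\<close>.\<close>
  from fg[OF f[OF this program_code_self_code[OF a_def bs]]]
  have "halts p (Suc a) \<longleftrightarrow> \<not> has_infinite_run ?P" using p by auto
  with infinite_run_imp_halts[OF _ n] halts_imp_infinite_run[OF _ n fits init] show False by blast
qed

end
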